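(* In the mixed $p$-spin spherical model with heavy-tailed interactions of tail exponent $\alpha<2$, there is $\epsilon'>0$ such that, with high probability, the ground state energy $\mathrm{GSE}=\max_{\sigma\in S_n}H_n(\sigma)$ satisfies $$\frac1n\,\mathrm{GSE}=\max_{p,\ |I|=p}|\alpha(p)H_{I,p}|\,p^{-p/2}+O(n^{-\epsilon'}).$$
   Context: Heavy-tailed variable: a real random variable $H$ is heavy-tailed with exponent $\alpha\in(0,2)$ if $\mathbb P(|H|>u)=L(u)u^{-\alpha}$ with $L$ slowly varying ($L(tx)/L(x)\to1$ as $x\to\infty$ for all $t>0$), and for every $\delta>0$ there is $x_0$ such that $L(x)e^{x^\delta}$ is increasing on $(x_0,\infty)$. Model: let $H$ be heavy-tailed with exponent $\alpha$. For $2\le p\le n$ and $I=\{i_1<\dots<i_p\}\subset\{1,\dots,n\}$ let $H'_I$ be i.i.d. copies of $H$; $b_{n,p}=\inf\{t:\mathbb P(|H|>t)<\binom np^{-1}\}$ and $H_{I,p}=H'_I\,b_{n,p}^{-1}$. The coefficients $\alpha(p)$, $p\ge2$, are fixed reals with $\sum_p|\alpha(p)|(1+\eta)^p<\infty$ for some $\eta>0$ (the function $p\mapsto\alpha(p)$ is unrelated to the exponent $\alpha$). The Hamiltonian is $$H_n(\sigma)=\sum_{p\ge2}\alpha(p)\sum_{|I|=p}H_{I,p}\,n^{-(p-2)/2}\prod_{i\in I}\sigma_i,$$ for $\sigma$ on the sphere $S_n=\{\sigma\in\mathbb R^n:\sum\sigma_i^2=n\}$. An event $E_n$ holds with high probability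 if there are $\delta>0$ and $n_0$ with $\mathbb P(E_n)\ge1-n^{-\delta}$ for all $n>n_0$. *)

theory Defs
  imports "HOL-Probability.Probability"
begin

definition slowly_varying :: "(real \<Rightarrow> real) \<Rightarrow> bool" where
  "slowly_varying L \<longleftrightarrow> (\<forall>t>0. ((\<lambda>x. L (t * x) / L x) \<longlongrightarrow> 1) at_top)"

definition abs_tail :: "'a measure \<Rightarrow> ('a \<Rightarrow> real) \<Rightarrow> real \<Rightarrow> real" where
  "abs_tail N H u = measure N {\<omega> \<in> space N. \<bar>H \<omega>\<bar> > u}"

text \<open>
  Weak monotonicity of \<open>L x * exp (x powr \<delta>)\<close> for every \<open>\<delta> > 0\<close> is equivalent to strict
  monotonicity for every \<open>\<delta> > 0\<close>, because \<open>L\<close> is eventually positive and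
  \<open>exp (x powr \<delta> - x powr (\<delta> / 2))\<close> is eventually strictly increasing.
\<close>
definition heavy_tailed :: "'a measure \<Rightarrow> ('a \<Rightarrow> real) \<Rightarrow> real \<Rightarrow> bool" where
  "heavy_tailed N H \<alpha> \<longleftrightarrow>
     0 < \<alpha> \<and> \<alpha> < 2 \<and>
     (\<exists>L. slowly_varying L \<and>
          (\<forall>u>0. abs_tail N H u = L u * u powr (- \<alpha>)) \<and>
          (\<forall>\<delta>>0. \<exists>x\<^sub>0. mono_on {x\<^sub>0<..} (\<lambda>x. L x * exp (x powr \<delta>))))"

definition scale :: "'a measure \<Rightarrow> ('a \<Rightarrow> real) \<Rightarrow> nat \<Rightarrow> nat \<Rightarrow> real" where
  "scale N H n p = Inf {t. abs_tail N H t < 1 / real (n choose p)}"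

text \<open>
  For \<open>p = n\<close> the scale is \<open>0\<close> if \<open>0\<close> lies in the support of \<open>H\<close>; the quotient is then \<open>0\<close>
  by the convention \<open>x / 0 = 0\<close>.
\<close>
definition normalized ::
    "'a measure \<Rightarrow> ('a \<Rightarrow> real) \<Rightarrow> nat \<Rightarrow> (nat set \<Rightarrow> real) \<Rightarrow> nat set \<Rightarrow> real" where
  "normalized N H n h I = h I / scale N H n (card I)"

text \<open>
  Vectors of \<open>\<real>\<^sup>n\<close> are functions on \<open>{1..n}\<close>, extended by \<open>undefined\<close>; the radius is
  \<open>sqrt n\<close>.
\<close>
definition spin_sphere :: "nat \<Rightarrow> (nat \<Rightarrow> real) set" where
  "spin_sphere n = {\<sigma> \<in> extensional {1..n}. (\<Sum>i=1..n. (\<sigma> i)\<^sup>2) = real n}"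

text \<open>The sum over \<open>p \<ge> 2\<close> stops at \<open>n\<close>, as \<open>{1..n}\<close> has no larger subsets.\<close>
definition hamiltonian ::
    "(nat \<Rightarrow> real) \<Rightarrow> nat \<Rightarrow> (nat set \<Rightarrow> real) \<Rightarrow> (nat \<Rightarrow> real) \<Rightarrow> real" where
  "hamiltonian a n J \<sigma> =
     (\<Sum>p=2..n. a p * (\<Sum>I | I \<subseteq> {1..n} \<and> card I = p.
        J I * real n powr (- (real p - 2) / 2) * (\<Prod>i\<in>I. \<sigma> i)))"

definition ground_state_energy :: "(nat \<Rightarrow> real) \<Rightarrow> nat \<Rightarrow> (nat set \<Rightarrow> real) \<Rightarrow> real" where
  "ground_state_energy a n J = (SUP \<sigma>\<in>spin_sphere n. hamiltonian a n J \<sigma>)"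

definition max_coupling :: "(nat \<Rightarrow> real) \<Rightarrow> nat \<Rightarrow> (nat set \<Rightarrow> real) \<Rightarrow> real" where
  "max_coupling a n J =
     Max {\<bar>a p * J I\<bar> * real p powr (- real p / 2) | p I.
            2 \<le> p \<and> p \<le> n \<and> I \<subseteq> {1..n} \<and> card I = p}"

definition with_high_probability :: "(nat \<Rightarrow> 'a measure) \<Rightarrow> (nat \<Rightarrow> 'a set) \<Rightarrow> bool" where
  "with_high_probability M E \<longleftrightarrow>
     (\<exists>\<delta>>0. \<exists>n\<^sub>0. \<forall>n>n\<^sub>0. E n \<in> sets (M n) \<and> measure (M n) (E n) \<ge> 1 - real n powr (- \<delta>))"

text \<open>The supremum in \<^const>\<open>ground_state_energy\<close> is a maximum.\<close>

lemma compact_spin_sphere: "compact (spin_sphere n)"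
proof -
  let ?B = "\<lambda>i::nat. if i \<in> {1..n} then {- sqrt (real n)..sqrt (real n)} else {undefined :: real}"
  have "compactin (product_topology (\<lambda>i::nat. euclidean :: real topology) UNIV) (PiE UNIV ?B)"
    by (subst compactin_PiE) auto
  then have c: "compact (PiE UNIV ?B)"
    by (simp add: euclidean_product_topology)
  have cl: "closed {\<sigma> :: nat \<Rightarrow> real. (\<Sum>i=1..n. (\<sigma> i)\<^sup>2) = real n}"
    by (intro closed_Collect_eq continuous_intros continuous_on_product_coordinates)
  have bound: "\<bar>\<sigma> i\<bar> \<le> sqrt (real n)"
    if "(\<Sum>i=1..n. (\<sigma> i)\<^sup>2) = real n" "i \<in> {1..n}" for \<sigma> :: "nat \<Rightarrow> real" and i
  proof -
    have "(\<sigma> i)\<^sup>2 \<le> (\<Sum>i=1..n. (\<sigma> i)\<^sup>2)"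
      by (rule member_le_sum) (use that in auto)
    then show ?thesis
      using that real_le_rsqrt[of "\<bar>\<sigma> i\<bar>" "real n"] by simp
  qed
  have "spin_sphere n = PiE UNIV ?B \<inter> {\<sigma>. (\<Sum>i=1..n. (\<sigma> i)\<^sup>2) = real n}"
  proof (intro equalityI subsetI)
    fix \<sigma> assume \<sigma>: "\<sigma> \<in> spin_sphere n"
    have "\<sigma> i \<in> ?B i" for i
      using \<sigma> bound[of \<sigma> i] by (auto simp: spin_sphere_def extensional_def abs_le_iff)
    then show "\<sigma> \<in> PiE UNIV ?B \<inter> {\<sigma>. (\<Sum>i=1..n. (\<sigma> i)\<^sup>2) = real n}"
      using \<sigma> by (simp add: spin_sphere_def PiE_UNIV_domain)
  next
    fix \<sigma> assume \<sigma>: "\<sigma> \<in> PiE UNIV ?B \<inter> {\<sigma>. (\<Sum>i=1..n. (\<sigma> i)\<^sup>2) = real n}"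
    then have "\<sigma> i \<in> ?B i" for i by blast
    then have "\<sigma> i = undefined" if "i \<notin> {1..n}" for i
      using that by (metis (no_types, lifting) singletonD)
    with \<sigma> show "\<sigma> \<in> spin_sphere n"
      by (simp add: spin_sphere_def extensional_def)
  qed
  with c cl show ?thesis by (simp add: compact_Int_closed)
qed

lemma spin_sphere_nonempty: "spin_sphere n \<noteq> {}"
proof -
  have "restrict (\<lambda>_. 1) {1..n} \<in> spin_sphere n" by (simp add: spin_sphere_def)
  then show ?thesis by blast
qed

lemma continuous_on_hamiltonian: "continuous_on S (hamiltonian a n J)"
proof -
  have "continuous_on UNIV (\<lambda>\<sigma>. hamiltonian a n J \<sigma>)"
    unfolding hamiltonian_def
    by (intro continuous_intros continuous_on_product_coordinates)
  then show ?thesis by (rule continuous_on_subset) simp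
qed

lemma ground_state_energy_attained:
  "\<exists>\<sigma>\<in>spin_sphere n. ground_state_energy a n J = hamiltonian a n J \<sigma>
     \<and> (\<forall>\<tau>\<in>spin_sphere n. hamiltonian a n J \<tau> \<le> hamiltonian a n J \<sigma>)"
proof -
  obtain \<sigma> where \<sigma>: "\<sigma> \<in> spin_sphere n"
      "\<forall>\<tau>\<in>spin_sphere n. hamiltonian a n J \<tau> \<le> hamiltonian a n J \<sigma>"
    using continuous_attains_sup[OF compact_spin_sphere spin_sphere_nonempty
        continuous_on_hamiltonian] by blast
  then have "ground_state_energy a n J = hamiltonian a n J \<sigma>"
    unfolding ground_state_energy_def by (intro cSup_eq_maximum) auto
  with \<sigma> show ?thesis by blast
qed

end

theory Submission
  imports Defs
begin

text \<open>
  On the unit sphere \<open>x = \<sigma> / sqrt n\<close> the normalized Hamiltonian is the multilinear form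
  \<open>\<Sum>I. w I * (\<Prod>i\<in>I. x i)\<close> with \<open>w I = a (card I) * J I\<close>. Averaging it over suitably tilted signs
  on a single set \<open>I\<close> shows that the ground state energy is at least \<open>n * max_coupling\<close>,
  deterministically. For the reverse bound, call a coupling large if \<open>\<bar>J I\<bar> > n powr (- 1/16)\<close>.
  As \<open>\<alpha> < 2\<close>, the sum of \<open>(w I)\<^sup>2\<close> over the other sets is polynomially small in expectation, so
  by Cauchy--Schwarz (and \<open>\<Sum>I. (\<Prod>i\<in>I. x i)\<^sup>2 \<le> exp 1\<close>) these sets are negligible uniformly on the
  sphere. The large sets with \<open>card I \<le> n powr (1/8)\<close> are so few that they are pairwise disjoint with
  high probability, and then, by AM--GM, they cannot jointly beat the best one of them. For larger sets
  the exponential decay of \<open>a\<close> absorbs any polynomial threshold in place of \<open>n powr (- 1/16)\<close>.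
\<close>

section \<open>Tails at the scale of the couplings\<close>

text \<open>The delicate point is uniformity: the sizes p run up to n, so every estimate must hold
  with one constant for all of them. Dividing by the scale helps: a set of size p exceeds a fixed
  level with probability at most of order 1 / (n choose p), so each size has bounded total weight
  and sums over sets become sums over p. The tail is used through two power bounds, with exponent
  \<open>\<beta>\<close> in (\<alpha>, 2) below the scale and \<open>\<gamma>\<close> in (0,
  \<alpha>) above it; \<open>\<beta> < 2\<close> makes the second moment truncated at
  \<open>\<tau>\<close> at most of order \<open>\<tau> powr (2 - \<beta>)\<close>. The thresholds
  n^(-1/16) for couplings and n^(1/8) for sizes are a compromise: a smaller \<open>\<tau>\<close>
  improves this second moment but creates more large sets, and the probability that two large sets
  of admissible size meet is at most of order n^(\<beta>/8 + 1/2 - 1), hence below order n^(-1/4).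
  For the lower bound, a vector supported on I still feels every coupling inside I; the tilted
  average cancels these exactly, so neither an error term nor an exceptional event appears
  there.\<close>

lemma dyadic_bracket:
  fixes t :: real
  assumes "t \<ge> 1"
  obtains k :: nat where "2 ^ k \<le> t" "t < 2 ^ Suc k"
proof -
  define k where "k = nat \<lfloor>log 2 t\<rfloor>"
  have l: "log 2 t \<ge> 0" using assms by simp
  have k: "real k \<le> log 2 t" "log 2 t < real (Suc k)"
    using l unfolding k_def by linarith+
  have "2 powr real k \<le> t" using k(1) assms by (simp add: le_log_iff)
  moreover have "t < 2 powr real (Suc k)" using k(2) assms by (simp add: log_less_iff del: of_nat_Suc)
  ultimately show ?thesis using that by (simp add: powr_realpow del: of_nat_Suc power_Suc)
qed

text \<open>Iterating the doubling step reaches \<open>2 ^ k * x\<close>; monotonicity rounds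
  \<open>t\<close> down to \<open>2 ^ k\<close>, at the price of the factor
  \<open>2 powr \<gamma>\<close>. This is a Potter-type bound obtained from the ratio 2
  alone.\<close>

lemma doubling_upper:
  fixes F :: "real \<Rightarrow> real"
  assumes anti: "antimono F" and "0 < x\<^sub>1" and nn: "\<And>x. F x \<ge> 0"
    and dbl: "\<And>x. x \<ge> x\<^sub>1 \<Longrightarrow> F (2 * x) \<le> 2 powr (- \<gamma>) * F x"
    and "\<gamma> > 0" "x \<ge> x\<^sub>1" "t \<ge> 1"
  shows "F (t * x) \<le> 2 powr \<gamma> * t powr (- \<gamma>) * F x"
proof -
  obtain k :: nat where k: "2 ^ k \<le> t" "t < 2 ^ Suc k"
    using dyadic_bracket[OF \<open>t \<ge> 1\<close>] by blast
  have it: "F (2 ^ j * x) \<le> (2 ^ j) powr (- \<gamma>) * F x" for j :: nat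
  proof (induction j)
    case (Suc j)
    have "x\<^sub>1 \<le> 2 ^ j * x"
      using assms(2,6) mult_mono[of 1 "2 ^ j" x\<^sub>1 x] by simp
    then have "F (2 * (2 ^ j * x)) \<le> 2 powr (- \<gamma>) * F (2 ^ j * x)" by (rule dbl)
    also have "\<dots> \<le> 2 powr (- \<gamma>) * ((2 ^ j) powr (- \<gamma>) * F x)"
      by (intro mult_left_mono Suc) simp
    finally show ?case by (simp add: powr_mult mult_ac)
  qed simp
  have "F (t * x) \<le> F (2 ^ k * x)"
    using k assms(2,6) by (intro antimonoD[OF anti] mult_right_mono) auto
  also have "\<dots> \<le> (2 ^ k) powr (- \<gamma>) * F x" by (rule it)
  also have "(2 ^ k :: real) powr (- \<gamma>) = 2 powr \<gamma> * (2 ^ Suc k) powr (- \<gamma>)"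
    by (simp add: powr_mult powr_minus field_simps)
  also have "\<dots> * F x \<le> 2 powr \<gamma> * t powr (- \<gamma>) * F x"
    using k assms(5,7) nn by (intro mult_right_mono mult_left_mono powr_mono2') auto
  finally show ?thesis .
qed

text \<open>Here \<open>t\<close> is rounded up to \<open>2 ^ Suc k\<close>, which is at most
  \<open>2 * t\<close>; this explains the factor 2 inside the power.\<close>

lemma doubling_lower:
  fixes F :: "real \<Rightarrow> real"
  assumes anti: "antimono F" and "0 < x\<^sub>1" and nn: "\<And>x. F x \<ge> 0"
    and dbl: "\<And>x. x \<ge> x\<^sub>1 \<Longrightarrow> 2 powr (- \<beta>) * F x \<le> F (2 * x)"
    and "\<beta> > 0" "x \<ge> x\<^sub>1" "t \<ge> 1"
  shows "F x \<le> (2 * t) powr \<beta> * F (t * x)"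
proof -
  obtain k :: nat where k: "2 ^ k \<le> t" "t < 2 ^ Suc k"
    using dyadic_bracket[OF \<open>t \<ge> 1\<close>] by blast
  have it: "F x \<le> (2 ^ j) powr \<beta> * F (2 ^ j * x)" for j :: nat
  proof (induction j)
    case (Suc j)
    have "x\<^sub>1 \<le> 2 ^ j * x"
      using assms(2,6) mult_mono[of 1 "2 ^ j" x\<^sub>1 x] by simp
    then have "2 powr (- \<beta>) * F (2 ^ j * x) \<le> F (2 * (2 ^ j * x))" by (rule dbl)
    then have "F (2 ^ j * x) \<le> 2 powr \<beta> * F (2 * (2 ^ j * x))"
      by (simp add: powr_minus field_simps)
    then have "(2 ^ j) powr \<beta> * F (2 ^ j * x)
        \<le> (2 ^ j) powr \<beta> * (2 powr \<beta> * F (2 * (2 ^ j * x)))"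
      by (intro mult_left_mono) auto
    also have "\<dots> = (2 ^ Suc j) powr \<beta> * F (2 ^ Suc j * x)" by (simp add: powr_mult mult_ac)
    finally show ?case using Suc by linarith
  qed simp
  have "F x \<le> (2 ^ Suc k) powr \<beta> * F (2 ^ Suc k * x)" by (rule it)
  also have "\<dots> \<le> (2 * t) powr \<beta> * F (t * x)"
    using k assms(2,5,6) nn
    by (intro mult_mono powr_mono2 antimonoD[OF anti] mult_right_mono) auto
  finally show ?thesis .
qed

lemma abs_tail_bounds:
  assumes N: "prob_space N"
  shows "0 \<le> abs_tail N H u" "abs_tail N H u \<le> 1" "u < 0 \<Longrightarrow> abs_tail N H u = 1"
proof -
  show "0 \<le> abs_tail N H u" "abs_tail N H u \<le> 1"
    by (simp_all add: abs_tail_def prob_space.prob_le_1[OF N])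
  assume "u < 0"
  then have "{\<omega> \<in> space N. \<bar>H \<omega>\<bar> > u} = space N" by (auto simp: less_le_trans)
  then show "abs_tail N H u = 1" by (simp add: abs_tail_def prob_space.prob_space[OF N])
qed

lemma antimono_abs_tail:
  assumes N: "prob_space N" and [measurable]: "H \<in> borel_measurable N"
  shows "antimono (abs_tail N H)"
proof (rule antimonoI)
  fix u v :: real assume "u \<le> v"
  then show "abs_tail N H v \<le> abs_tail N H u"
    unfolding abs_tail_def
    by (intro finite_measure.finite_measure_mono[OF prob_space.finite_measure[OF N]]) auto
qed

text \<open>Slow variation at the factor 2 makes the ratio of the tails at \<open>2 * x\<close> and
  \<open>x\<close> converge to \<open>2 powr (- \<alpha>)\<close>, which lies strictly between the
  two bounds.\<close>

lemma heavy_tailed_doubling: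
  assumes N: "prob_space N" and "H \<in> borel_measurable N" and ht: "heavy_tailed N H \<alpha>"
    and "\<gamma> < \<alpha>" "\<alpha> < \<beta>"
  obtains x\<^sub>1 where "0 < x\<^sub>1"
    "\<And>x. x \<ge> x\<^sub>1 \<Longrightarrow> 2 powr (- \<beta>) * abs_tail N H x \<le> abs_tail N H (2 * x)"
    "\<And>x. x \<ge> x\<^sub>1 \<Longrightarrow> abs_tail N H (2 * x) \<le> 2 powr (- \<gamma>) * abs_tail N H x"
    "\<And>x. x \<ge> x\<^sub>1 \<Longrightarrow> 0 < abs_tail N H x"
proof -
  let ?F = "abs_tail N H"
  obtain L where L: "slowly_varying L" "\<And>u. u > 0 \<Longrightarrow> ?F u = L u * u powr (- \<alpha>)"
    using ht by (auto simp: heavy_tailed_def)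
  have "((\<lambda>x. L (2 * x) / L x * 2 powr (- \<alpha>)) \<longlongrightarrow> 1 * 2 powr (- \<alpha>)) at_top"
    using L(1) by (intro tendsto_intros) (auto simp: slowly_varying_def)
  moreover have "eventually (\<lambda>x. L (2 * x) / L x * 2 powr (- \<alpha>) = ?F (2 * x) / ?F x) at_top"
    using eventually_gt_at_top[of "0::real"]
    by eventually_elim (simp add: L(2) powr_mult)
  ultimately have lim: "((\<lambda>x. ?F (2 * x) / ?F x) \<longlongrightarrow> 2 powr (- \<alpha>)) at_top"
    by (simp add: filterlim_cong)
  have "eventually (\<lambda>x. 2 powr (- \<beta>) < ?F (2 * x) / ?F x) at_top"
    using order_tendstoD(1)[OF lim, of "2 powr (- \<beta>)"] assms by simp
  moreover have "eventually (\<lambda>x. ?F (2 * x) / ?F x < 2 powr (- \<gamma>)) at_top"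
    using order_tendstoD(2)[OF lim, of "2 powr (- \<gamma>)"] assms by simp
  ultimately have "eventually (\<lambda>x. 0 < x \<and> 2 powr (- \<beta>) < ?F (2 * x) / ?F x
      \<and> ?F (2 * x) / ?F x < 2 powr (- \<gamma>)) at_top"
    using eventually_gt_at_top[of "0::real"] by eventually_elim auto
  then obtain x\<^sub>1 where x1: "\<And>x. x \<ge> x\<^sub>1 \<Longrightarrow> 0 < x \<and> 2 powr (- \<beta>) < ?F (2 * x) / ?F x
      \<and> ?F (2 * x) / ?F x < 2 powr (- \<gamma>)"
    by (auto simp: eventually_at_top_linorder)
  have pos: "0 < ?F x" if "x \<ge> x\<^sub>1" for x
  proof -
    \<comment> \<open>A vanishing tail would make the quotient 0 by the convention for division by
      zero, against its positive lower bound.\<close>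
    have "?F x \<noteq> 0"
    proof
      assume "?F x = 0"
      then have "2 powr (- \<beta>) < 0" using x1[OF that] by simp
      then show False using powr_ge_zero[of 2 "- \<beta>"] by linarith
    qed
    then show ?thesis using abs_tail_bounds(1)[OF N, of H x] by linarith
  qed
  show ?thesis
  proof (rule that[of x\<^sub>1])
    fix x assume x: "x \<ge> x\<^sub>1"
    show "2 powr (- \<beta>) * ?F x \<le> ?F (2 * x)" "?F (2 * x) \<le> 2 powr (- \<gamma>) * ?F x" "0 < ?F x"
      using x1[OF x] pos[OF x] by (simp_all add: field_simps)
  qed (use x1 in auto)
qed

text \<open>Continuity from above along the integers. It makes the set in \<open>scale\<close>
  nonempty, without which its \<open>Inf\<close> would carry no information.\<close>

lemma abs_tail_vanishes:
  assumes N: "prob_space N" and "H \<in> borel_measurable N" and "e > 0"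
  obtains t where "abs_tail N H t < e"
proof -
  note assms(2)[measurable]
  have "(\<lambda>k. measure N {\<omega> \<in> space N. \<bar>H \<omega>\<bar> > real k})
      \<longlonglongrightarrow> measure N (\<Inter>k. {\<omega> \<in> space N. \<bar>H \<omega>\<bar> > real k})"
    by (rule finite_measure.finite_Lim_measure_decseq[OF prob_space.finite_measure[OF N]])
      (auto simp: decseq_def)
  also have "(\<Inter>k. {\<omega> \<in> space N. \<bar>H \<omega>\<bar> > real k}) = {}"
  proof -
    have "\<exists>k::nat. \<not> \<bar>H \<omega>\<bar> > real k" for \<omega>
      using reals_Archimedean2[of "\<bar>H \<omega>\<bar>"] by (meson less_asym)
    then show ?thesis by blast
  qed
  finally have "eventually (\<lambda>k. abs_tail N H (real k) < e) sequentially"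
    unfolding abs_tail_def using \<open>e > 0\<close> by (intro order_tendstoD(2)) auto
  then show ?thesis using that by (auto simp: eventually_sequentially)
qed

lemma abs_tail_threshold_nonneg:
  assumes N: "prob_space N" and "p \<le> n" "abs_tail N H t < 1 / real (n choose p)"
  shows "0 \<le> t"
proof -
  have "0 < n choose p" using assms(2) by simp
  then have "1 \<le> real (n choose p)" by linarith
  then have "1 / real (n choose p) \<le> 1" by (metis divide_le_eq_1_pos less_le_trans zero_less_one)
  with assms(3) show "0 \<le> t" using abs_tail_bounds(3)[OF N, of t H] by fastforce
qed

lemma scale_nonneg:
  assumes N: "prob_space N" and H: "H \<in> borel_measurable N" and "p \<le> n"
  shows "0 \<le> scale N H n p"
proof -
  obtain s where "abs_tail N H s < 1 / real (n choose p)"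
    using abs_tail_vanishes[OF N H, of "1 / real (n choose p)"] assms(3) by auto
  then show ?thesis
    unfolding scale_def using abs_tail_threshold_nonneg[OF N assms(3)] by (intro cInf_greatest) auto
qed

text \<open>No right-continuity is used: the tail is compared with its value at twice the scale.\<close>
lemma scaled_tail_bound:
  assumes N: "prob_space N" and H: "H \<in> borel_measurable N" and ht: "heavy_tailed N H \<alpha>"
    and g: "0 < \<gamma>" "\<gamma> < \<alpha>" "\<alpha> < \<beta>"
  obtains C n\<^sub>0 where "C \<ge> 1"
    "\<And>n p u. n \<ge> n\<^sub>0 \<Longrightarrow> 2 \<le> p \<Longrightarrow> p \<le> n \<Longrightarrow> 0 < scale N H n p \<Longrightarrow> 0 < u \<Longrightarrow> u \<le> 1 \<Longrightarrow>
        abs_tail N H (u * scale N H n p) \<le> C * u powr (- \<beta>) / real (n choose p)"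
    "\<And>n p u. n \<ge> n\<^sub>0 \<Longrightarrow> 2 \<le> p \<Longrightarrow> p \<le> n \<Longrightarrow> 0 < scale N H n p \<Longrightarrow> 1 \<le> u \<Longrightarrow>
        abs_tail N H (u * scale N H n p) \<le> C * u powr (- \<gamma>) / real (n choose p)"
proof -
  let ?F = "abs_tail N H"
  note F01 = abs_tail_bounds(1,2)[OF N, of H]
  note anti = antimono_abs_tail[OF N H]
  obtain x\<^sub>1 where x1: "0 < x\<^sub>1"
    "\<And>x. x \<ge> x\<^sub>1 \<Longrightarrow> 2 powr (- \<beta>) * ?F x \<le> ?F (2 * x)"
    "\<And>x. x \<ge> x\<^sub>1 \<Longrightarrow> ?F (2 * x) \<le> 2 powr (- \<gamma>) * ?F x"
    "\<And>x. x \<ge> x\<^sub>1 \<Longrightarrow> 0 < ?F x"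
    using heavy_tailed_doubling[OF N H ht g(2,3)] by blast
  have up: "?F (t * x) \<le> 2 powr \<gamma> * t powr (- \<gamma>) * ?F x" if "x \<ge> x\<^sub>1" "t \<ge> 1" for x t
    by (rule doubling_upper[where F = ?F and x = x and t = t, OF anti x1(1) F01(1) x1(3)]) (use that g in auto)
  have lo: "?F x \<le> (2 * t) powr \<beta> * ?F (t * x)" if "x \<ge> x\<^sub>1" "t \<ge> 1" for x t
    by (rule doubling_lower[where F = ?F and x = x and t = t, OF anti x1(1) F01(1) x1(2)]) (use that g in auto)
  have bdd: "bdd_below {t. ?F t < 1 / real (n choose p)}" if "p \<le> n" for n p
    using abs_tail_threshold_nonneg[OF N that] by (intro bdd_belowI[of _ 0]) auto
  have above: "?F t < 1 / real (n choose p)" if t: "t > scale N H n p" and p: "p \<le> n" for t n p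
  proof -
    obtain s where "?F s < 1 / real (n choose p)"
      using abs_tail_vanishes[OF N H, of "1 / real (n choose p)"] p by auto
    then have "{t. ?F t < 1 / real (n choose p)} \<noteq> {}" by auto
    then obtain s where "?F s < 1 / real (n choose p)" "s < t"
      using t bdd[OF p] by (auto simp: scale_def cInf_less_iff)
    then show ?thesis using antimonoD[OF anti, of s t] by linarith
  qed
  \<comment> \<open>From \<open>n\<^sub>0\<close> on, \<open>1 / real n\<close> is at most the tail
    at \<open>x\<^sub>1\<close>. Since \<open>n choose p\<close> is at least \<open>n\<close> for
    \<open>1 \<le> p < n\<close>, all scales with \<open>p < n\<close> then lie in the region where
    the doubling bounds hold. The size \<open>p = n\<close> has binomial 1 and is exempt.\<close>
  define n\<^sub>0 where "n\<^sub>0 = nat \<lceil>1 / ?F x\<^sub>1\<rceil>"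
  have scale_ge: "x\<^sub>1 \<le> scale N H n p" if np: "n \<ge> n\<^sub>0" "2 \<le> p" "p < n" for n p
  proof -
    have "n \<le> n choose p"
    proof -
      have "n choose 1 \<le> n choose p"
      proof (cases "2 * p \<le> n")
        case True then show ?thesis using that by (intro binomial_mono) auto
      next
        case False
        have "n choose 1 \<le> n choose (n - p)" using that False by (intro binomial_mono) auto
        also have "\<dots> = n choose p" using that by (simp add: binomial_symmetric[symmetric])
        finally show ?thesis .
      qed
      then show ?thesis by simp
    qed
    moreover have "1 / ?F x\<^sub>1 \<le> real n" using that(1) unfolding n\<^sub>0_def by linarith
    ultimately have "1 / ?F x\<^sub>1 \<le> real (n choose p)" by linarith
    then have le: "1 / real (n choose p) \<le> ?F x\<^sub>1"
      using x1(4)[of x\<^sub>1] that by (simp add: field_simps)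
    obtain s where "?F s < 1 / real (n choose p)"
      using abs_tail_vanishes[OF N H, of "1 / real (n choose p)"] np by auto
    moreover have "x\<^sub>1 \<le> t" if "?F t < 1 / real (n choose p)" for t
      using that le antimonoD[OF anti, of t x\<^sub>1] by (rule_tac ccontr) auto
    ultimately show ?thesis unfolding scale_def by (intro cInf_greatest) auto
  qed
  \<comment> \<open>The base 4 collects one factor 2 from evaluating at twice the scale and one from
    \<open>doubling_lower\<close>. Division by the tail at \<open>x\<^sub>1\<close> covers the
    arguments below \<open>x\<^sub>1\<close>.\<close>
  define C\<^sub>1 where "C\<^sub>1 = 4 powr \<beta> / ?F x\<^sub>1"
  have F1: "0 < ?F x\<^sub>1" "?F x\<^sub>1 \<le> 1" using x1(4)[of x\<^sub>1] F01 by auto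
  have C1: "4 powr \<beta> \<le> C\<^sub>1" "1 \<le> C\<^sub>1"
  proof -
    show *: "4 powr \<beta> \<le> C\<^sub>1" using F1 by (simp add: C\<^sub>1_def field_simps)
    have "1 \<le> 4 powr \<beta>" using g by (intro ge_one_powr_ge_zero) auto
    with * show "1 \<le> C\<^sub>1" by linarith
  qed
  have small: "?F (u * scale N H n p) \<le> C\<^sub>1 * u powr (- \<beta>) / real (n choose p)"
    if np: "n \<ge> n\<^sub>0" "2 \<le> p" "p < n" and u: "0 < u" "u \<le> 1" for n p u
  proof -
    define b where "b = scale N H n p"
    have b: "x\<^sub>1 \<le> b" "0 < b" using scale_ge[OF np] x1(1) by (auto simp: b_def)
    have F2b: "?F (2 * b) \<le> 1 / real (n choose p)"
      using above[of n p "2 * b"] np b unfolding b_def by auto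
    have u4: "(2 * (2 / u)) powr \<beta> = 4 powr \<beta> * u powr (- \<beta>)"
      using u by (simp add: powr_divide powr_minus field_simps)
    have "?F (u * b) \<le> C\<^sub>1 * u powr (- \<beta>) * ?F (2 * b)"
    proof (cases "x\<^sub>1 \<le> u * b")
      case True
      have "?F (u * b) \<le> (2 * (2 / u)) powr \<beta> * ?F (2 / u * (u * b))"
        using True u by (intro lo) auto
      also have "\<dots> = 4 powr \<beta> * u powr (- \<beta>) * ?F (2 * b)" using u u4 by simp
      also have "\<dots> \<le> C\<^sub>1 * u powr (- \<beta>) * ?F (2 * b)"
        using C1 F01 by (intro mult_right_mono) auto
      finally show ?thesis .
    next
      \<comment> \<open>Below \<open>x\<^sub>1\<close> the doubling bounds say nothing, so the tail
        is bounded by 1. Comparing \<open>x\<^sub>1\<close> with \<open>2 * b\<close>, where now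
        \<open>b < x\<^sub>1 / u\<close>, shows that the claimed bound is at least 1.\<close>
      case False
      have "?F x\<^sub>1 \<le> (2 * (2 * b / x\<^sub>1)) powr \<beta> * ?F (2 * b / x\<^sub>1 * x\<^sub>1)"
        using b x1(1) by (intro lo) auto
      also have "\<dots> \<le> (2 * (2 / u)) powr \<beta> * ?F (2 * b)"
        using False u b x1(1) g F01
        by (intro mult_mono powr_mono2) (auto simp: field_simps)
      finally have "?F x\<^sub>1 \<le> 4 powr \<beta> * u powr (- \<beta>) * ?F (2 * b)" using u4 by simp
      then have "1 \<le> C\<^sub>1 * u powr (- \<beta>) * ?F (2 * b)"
        using F1 by (simp add: C\<^sub>1_def field_simps)
      then show ?thesis using F01(2)[of "u * b"] by linarith
    qed
    also have "\<dots> \<le> C\<^sub>1 * u powr (- \<beta>) * (1 / real (n choose p))"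
      using F2b C1 by (intro mult_left_mono) auto
    finally show ?thesis by (simp add: b_def)
  qed
  define C\<^sub>2 where "C\<^sub>2 = 2 powr \<gamma> * C\<^sub>1"
  have C2: "C\<^sub>1 \<le> C\<^sub>2"
    using C1 g mult_right_mono[of 1 "2 powr \<gamma>" C\<^sub>1] ge_one_powr_ge_zero[of 2 \<gamma>]
    by (simp add: C\<^sub>2_def)
  have large: "?F (u * scale N H n p) \<le> C\<^sub>2 * u powr (- \<gamma>) / real (n choose p)"
    if np: "n \<ge> n\<^sub>0" "2 \<le> p" "p < n" and u: "1 \<le> u" for n p u
  proof -
    have "?F (u * scale N H n p) \<le> 2 powr \<gamma> * u powr (- \<gamma>) * ?F (scale N H n p)"
      using scale_ge[OF np] u by (intro up) auto
    also have "\<dots> \<le> 2 powr \<gamma> * u powr (- \<gamma>) * (C\<^sub>1 / real (n choose p))"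
      using small[OF np, of 1] by (intro mult_left_mono) auto
    finally show ?thesis by (simp add: C\<^sub>2_def mult_ac)
  qed
  \<comment> \<open>For \<open>p = n\<close> the scale is a constant independent of
    \<open>n\<close>, possibly below \<open>x\<^sub>1\<close>, so this size gets its own constant
    \<open>C\<^sub>3\<close>. For \<open>u \<le> 1\<close> its bound is trivial, the right-hand side
    being at least 1.\<close>
  define B where "B = Inf {t. ?F t < 1}"
  have B: "scale N H n n = B" for n by (simp add: scale_def B_def)
  define C\<^sub>3 where "C\<^sub>3 = 2 powr \<gamma> * (x\<^sub>1 / B) powr \<gamma>"
  have full: "?F (u * B) \<le> C\<^sub>3 * u powr (- \<gamma>)" if "B > 0" "u \<ge> 1" for u
  proof (cases "x\<^sub>1 \<le> u * B")
    case True
    have "?F (u * B / x\<^sub>1 * x\<^sub>1) \<le> 2 powr \<gamma> * (u * B / x\<^sub>1) powr (- \<gamma>) * ?F x\<^sub>1"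
      using True x1(1) by (intro up) (auto simp: field_simps)
    also have "\<dots> \<le> 2 powr \<gamma> * (u * B / x\<^sub>1) powr (- \<gamma>) * 1"
      using F01 by (intro mult_left_mono) auto
    also have "\<dots> = C\<^sub>3 * u powr (- \<gamma>)"
      using that x1(1) by (simp add: C\<^sub>3_def powr_divide powr_mult powr_minus field_simps)
    finally show ?thesis using x1(1) by simp
  next
    case False
    have "1 \<le> x\<^sub>1 / B / u" using False that by (simp add: field_simps)
    then have "1 \<le> (x\<^sub>1 / B / u) powr \<gamma>" using g by (intro ge_one_powr_ge_zero) auto
    also have "\<dots> = (x\<^sub>1 / B) powr \<gamma> * u powr (- \<gamma>)"
      using that x1(1) by (simp add: powr_divide powr_mult powr_minus field_simps)
    also have "\<dots> \<le> C\<^sub>3 * u powr (- \<gamma>)"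
      using g mult_right_mono[of 1 "2 powr \<gamma>" "(x\<^sub>1 / B) powr \<gamma> * u powr (- \<gamma>)"]
        ge_one_powr_ge_zero[of 2 \<gamma>]
      by (simp add: C\<^sub>3_def mult_ac)
    finally show ?thesis using F01(2)[of "u * B"] by linarith
  qed
  define C where "C = max C\<^sub>2 C\<^sub>3"
  show ?thesis
  proof (rule that[of C n\<^sub>0])
    show C_ge: "C \<ge> 1" using C1 C2 by (simp add: C_def)
    fix n p :: nat and u :: real
    assume np: "n \<ge> n\<^sub>0" "2 \<le> p" "p \<le> n" and s: "0 < scale N H n p"
    {
      assume u: "0 < u" "u \<le> 1"
      show "?F (u * scale N H n p) \<le> C * u powr (- \<beta>) / real (n choose p)"
      proof (cases "p = n")
        case True
        have "1 \<le> 1 * u powr (- \<beta>)" using u g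
          by (simp add: powr_minus field_simps powr_le1)
        also have "\<dots> \<le> C * u powr (- \<beta>)" using C_ge by (intro mult_right_mono) auto
        finally show ?thesis using True F01(2)[of "u * scale N H n p"] by simp
      next
        case False
        have "?F (u * scale N H n p) \<le> C\<^sub>1 * u powr (- \<beta>) / real (n choose p)"
          using np False u by (intro small) auto
        also have "\<dots> \<le> C * u powr (- \<beta>) / real (n choose p)"
          using C2 by (intro divide_right_mono mult_right_mono) (auto simp: C_def)
        finally show ?thesis .
      qed
    }
    assume u: "1 \<le> u"
    show "?F (u * scale N H n p) \<le> C * u powr (- \<gamma>) / real (n choose p)"
    proof (cases "p = n")
      case True
      then have "?F (u * scale N H n p) \<le> C\<^sub>3 * u powr (- \<gamma>)" using full s u B by simp
      also have "\<dots> \<le> C * u powr (- \<gamma>)" by (intro mult_right_mono) (auto simp: C_def)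
      finally show ?thesis using True by simp
    next
      case False
      have "?F (u * scale N H n p) \<le> C\<^sub>2 * u powr (- \<gamma>) / real (n choose p)"
        using np False u by (intro large) auto
      also have "\<dots> \<le> C * u powr (- \<gamma>) / real (n choose p)"
        by (intro divide_right_mono mult_right_mono) (auto simp: C_def)
      finally show ?thesis .
    qed
  qed
qed

section \<open>Multilinear forms on the sphere\<close>

text \<open>The left side is the expansion of the product of the \<open>1 + y i\<close>. With
  \<open>y i = (x i)\<^sup>2\<close> on the unit sphere the bound is \<open>exp 1\<close>, whatever
  the dimension and for all sizes of \<open>I\<close> at once.\<close>

lemma sum_prod_Pow_le_exp:
  fixes y :: "'i \<Rightarrow> real"
  assumes "finite A" "\<And>i. i \<in> A \<Longrightarrow> 0 \<le> y i"
  shows "(\<Sum>I\<in>Pow A. \<Prod>i\<in>I. y i) \<le> exp (\<Sum>i\<in>A. y i)"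
proof -
  have "(\<Sum>I\<in>Pow A. \<Prod>i\<in>I. y i) = (\<Prod>i\<in>A. y i + 1)"
    using prod_add[OF assms(1), of y "\<lambda>_. 1"] by simp
  also have "\<dots> \<le> (\<Prod>i\<in>A. exp (y i))"
    using assms by (intro prod_mono) (auto simp: add.commute add_nonneg_nonneg)
  finally show ?thesis by (simp add: exp_sum assms(1))
qed

text \<open>AM-GM gives the mass to the power \<open>card I / 2\<close>. As the mass is at most 1
  and \<open>card I \<ge> 2\<close>, this is at most the mass itself, and a bound linear in the mass
  can be added over disjoint sets.\<close>

lemma abs_prod_le_card_powr:
  fixes x :: "'i \<Rightarrow> real"
  assumes "finite I" "2 \<le> card I" "(\<Sum>i\<in>I. (x i)\<^sup>2) \<le> 1"
  shows "\<bar>\<Prod>i\<in>I. x i\<bar> \<le> real (card I) powr (- real (card I) / 2) * (\<Sum>i\<in>I. (x i)\<^sup>2)"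
proof -
  define p where "p = real (card I)"
  define S where "S = (\<Sum>i\<in>I. (x i)\<^sup>2)"
  have p: "p \<ge> 2" using assms by (simp add: p_def)
  have ne: "I \<noteq> {}" using assms by auto
  have S: "0 \<le> S" "S \<le> 1" using assms by (auto simp: S_def sum_nonneg)
  have P: "(\<Prod>i\<in>I. (x i)\<^sup>2) = \<bar>\<Prod>i\<in>I. x i\<bar> powr 2"
    by (simp add: prod_power_distrib powr_numeral[symmetric])
  have "(\<Prod>i\<in>I. (x i)\<^sup>2) powr (1 / p) \<le> S / p"
    using arith_geom_mean[OF assms(1) ne, of "\<lambda>i. (x i)\<^sup>2"]
    by (simp add: p_def S_def sum_divide_distrib)
  then have "((\<Prod>i\<in>I. (x i)\<^sup>2) powr (1 / p)) powr (p / 2) \<le> (S / p) powr (p / 2)"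
    using p by (intro powr_mono2) auto
  also have "((\<Prod>i\<in>I. (x i)\<^sup>2) powr (1 / p)) powr (p / 2) = \<bar>\<Prod>i\<in>I. x i\<bar>"
    using p by (simp add: P powr_powr)
  also have "(S / p) powr (p / 2) = p powr (- p / 2) * S powr (p / 2)"
    using p S by (simp add: powr_divide powr_minus field_simps)
  also have "\<dots> \<le> p powr (- p / 2) * S powr 1"
  proof (intro mult_left_mono)
    show "S powr (p / 2) \<le> S powr 1" using p S by (intro powr_mono') auto
  qed auto
  finally show ?thesis using S by (simp add: p_def S_def)
qed

text \<open>The members of a pairwise disjoint family compete for the mass of \<open>x\<close>, so together they
  contribute no more than the best of them; the rest is controlled by Cauchy--Schwarz.\<close>
lemma multilinear_form_upper:
  fixes x :: "'i \<Rightarrow> real" and w :: "'i set \<Rightarrow> real"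
  assumes A: "finite A" and x: "(\<Sum>i\<in>A. (x i)\<^sup>2) = 1"
    and K: "K \<subseteq> Pow A" "\<And>I. I \<in> K \<Longrightarrow> 2 \<le> card I"
    and D: "D \<subseteq> K" "pairwise disjnt D"
    and m: "0 \<le> m" "\<And>I. I \<in> D \<Longrightarrow> \<bar>w I\<bar> * real (card I) powr (- real (card I) / 2) \<le> m"
  shows "(\<Sum>I\<in>K. w I * (\<Prod>i\<in>I. x i)) \<le> m + sqrt (exp 1 * (\<Sum>I\<in>K - D. (w I)\<^sup>2))"
proof -
  have fK: "finite K" using finite_subset[OF K(1)] A by simp
  have fin: "finite I" if "I \<in> K" for I using finite_subset[of I A] K A that by auto
  have "(\<Sum>I\<in>D. w I * (\<Prod>i\<in>I. x i)) \<le> (\<Sum>I\<in>D. m * (\<Sum>i\<in>I. (x i)\<^sup>2))"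
  proof (rule sum_mono)
    fix I assume I: "I \<in> D"
    then have IK: "I \<in> K" using D by auto
    have "(\<Sum>i\<in>I. (x i)\<^sup>2) \<le> 1"
      unfolding x[symmetric] using K IK A by (intro sum_mono2) auto
    then have "\<bar>w I\<bar> * \<bar>\<Prod>i\<in>I. x i\<bar>
        \<le> \<bar>w I\<bar> * (real (card I) powr (- real (card I) / 2) * (\<Sum>i\<in>I. (x i)\<^sup>2))"
      using fin[OF IK] K(2)[OF IK] by (intro mult_left_mono abs_prod_le_card_powr) auto
    also have "\<dots> \<le> m * (\<Sum>i\<in>I. (x i)\<^sup>2)"
      using mult_right_mono[OF m(2)[OF I], of "\<Sum>i\<in>I. (x i)\<^sup>2"] by (simp add: sum_nonneg mult_ac)
    finally show "w I * (\<Prod>i\<in>I. x i) \<le> m * (\<Sum>i\<in>I. (x i)\<^sup>2)"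
      by (simp add: abs_mult[symmetric] abs_le_iff)
  qed
  also have "\<dots> = m * (\<Sum>i\<in>\<Union>D. (x i)\<^sup>2)"
  proof -
    have "(\<Sum>i\<in>\<Union>D. (x i)\<^sup>2) = (\<Sum>I\<in>D. \<Sum>i\<in>I. (x i)\<^sup>2)"
      using D fin by (intro sum.Union_disjoint[unfolded comp_def])
        (auto simp: pairwise_def disjnt_def)
    then show ?thesis by (simp add: sum_distrib_left)
  qed
  also have "\<dots> \<le> m * 1"
    unfolding x[symmetric] using K D A m by (intro mult_left_mono sum_mono2) auto
  finally have 1: "(\<Sum>I\<in>D. w I * (\<Prod>i\<in>I. x i)) \<le> m" by simp
  have "(\<Sum>I\<in>K - D. w I * (\<Prod>i\<in>I. x i))\<^sup>2
      \<le> (\<Sum>I\<in>K - D. (w I)\<^sup>2) * (\<Sum>I\<in>K - D. (\<Prod>i\<in>I. x i)\<^sup>2)"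
    by (rule Cauchy_Schwarz_ineq_sum)
  also have "(\<Sum>I\<in>K - D. (\<Prod>i\<in>I. x i)\<^sup>2) \<le> (\<Sum>I\<in>Pow A. \<Prod>i\<in>I. (x i)\<^sup>2)"
    unfolding prod_power_distrib[symmetric]
    using A K by (intro sum_mono2) (auto intro!: prod_nonneg)
  also have "\<dots> \<le> exp 1"
    using sum_prod_Pow_le_exp[OF A, of "\<lambda>i. (x i)\<^sup>2"] x by simp
  finally have "(\<Sum>I\<in>K - D. w I * (\<Prod>i\<in>I. x i))\<^sup>2 \<le> (\<Sum>I\<in>K - D. (w I)\<^sup>2) * exp 1"
    by (simp add: mult_left_mono sum_nonneg)
  then have "(\<Sum>I\<in>K - D. w I * (\<Prod>i\<in>I. x i))\<^sup>2 \<le> exp 1 * (\<Sum>I\<in>K - D. (w I)\<^sup>2)"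
    by (simp only: mult.commute)
  then have 2: "(\<Sum>I\<in>K - D. w I * (\<Prod>i\<in>I. x i)) \<le> sqrt (exp 1 * (\<Sum>I\<in>K - D. (w I)\<^sup>2))"
    by (rule real_le_rsqrt)
  have "(\<Sum>I\<in>K. w I * (\<Prod>i\<in>I. x i))
      = (\<Sum>I\<in>D. w I * (\<Prod>i\<in>I. x i)) + (\<Sum>I\<in>K - D. w I * (\<Prod>i\<in>I. x i))"
    using sum.subset_diff[OF D(1) fK, of "\<lambda>I. w I * (\<Prod>i\<in>I. x i)"] by simp
  with 1 2 show ?thesis by linarith
qed

text \<open>Orthogonality of the Walsh characters; \<open>D\<close> encodes a sign vector by the
  positions of its minus signs. Both \<open>B\<close> seen from \<open>D\<close> and
  \<open>D\<close> seen from \<open>B\<close> give (-1) to the power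
  \<open>card (B \<inter> D)\<close>. After this exchange the sum factorizes over \<open>A\<close>,
  and each point of \<open>B\<close> contributes a factor 0.\<close>

lemma sum_Pow_prod_sign:
  assumes "finite A" "B \<subseteq> A"
  shows "(\<Sum>D\<in>Pow A. \<Prod>i\<in>B. if i \<in> D then - 1 else 1 :: real) = (if B = {} then 2 ^ card A else 0)"
proof -
  have "(\<Sum>D\<in>Pow A. \<Prod>i\<in>B. if i \<in> D then - 1 else 1 :: real)
      = (\<Sum>D\<in>Pow A. (\<Prod>i\<in>D. if i \<in> B then - 1 else 1) * (\<Prod>i\<in>A - D. 1))"
  proof (rule sum.cong)
    fix D assume "D \<in> Pow A"
    then have f: "finite D" "finite B" using assms finite_subset by auto
    have "(\<Prod>i\<in>B. if i \<in> D then - 1 else 1 :: real) = (\<Prod>i\<in>B \<inter> D. - 1)"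
      using f by (subst prod.inter_restrict) auto
    also have "\<dots> = (\<Prod>i\<in>D. if i \<in> B then - 1 else 1)"
      using f by (subst Int_commute, subst prod.inter_restrict) auto
    finally show "(\<Prod>i\<in>B. if i \<in> D then - 1 else 1 :: real)
      = (\<Prod>i\<in>D. if i \<in> B then - 1 else 1) * (\<Prod>i\<in>A - D. 1)" by simp
  qed simp
  also have "\<dots> = (\<Prod>i\<in>A. (if i \<in> B then - 1 else 1) + 1)"
    by (rule prod_add[symmetric]) fact
  also have "\<dots> = (if B = {} then 2 ^ card A else 0)"
    using assms by auto
  finally show ?thesis .
qed

text \<open>Tilting the uniform measure on sign vectors on \<open>I\<close> by \<open>1 + s * (product of all signs)\<close> kills
  every monomial of the form except that of \<open>I\<close>.\<close>
lemma multilinear_form_lower: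
  fixes w :: "'i set \<Rightarrow> real"
  assumes A: "finite A" and K: "K \<subseteq> Pow A" "\<And>I. I \<in> K \<Longrightarrow> I \<noteq> {}" and I: "I \<in> K"
    and ub: "\<And>x. (\<Sum>i\<in>A. (x i)\<^sup>2) = 1 \<Longrightarrow> (\<Sum>J\<in>K. w J * (\<Prod>i\<in>J. x i)) \<le> G"
  shows "\<bar>w I\<bar> * real (card I) powr (- real (card I) / 2) \<le> G"
proof -
  define p where "p = card I"
  have fI: "finite I" "I \<noteq> {}" "I \<subseteq> A" using A K I finite_subset[of I A] by auto
  then have p: "p > 0" by (simp add: p_def card_gt_0_iff)
  have fK: "finite K" using finite_subset[OF K(1)] A by simp
  define \<epsilon> :: "'i set \<Rightarrow> 'i \<Rightarrow> real" where "\<epsilon> D i = (if i \<in> D then - 1 else 1)" for D i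
  define x :: "'i set \<Rightarrow> 'i \<Rightarrow> real" where "x D i = (if i \<in> I then \<epsilon> D i / sqrt p else 0)" for D i
  \<comment> \<open>With this \<open>s\<close> the surviving term has coefficient
    \<open>\<bar>w I\<bar>\<close>, and \<open>\<bar>s\<bar> \<le> 1\<close> keeps the weights
    \<open>c D\<close> nonnegative, so that the average respects the upper bound
    \<open>G\<close>.\<close>
  define s where "s = sgn (w I)"
  define c where "c D = 1 + s * (\<Prod>i\<in>I. \<epsilon> D i)" for D
  have \<epsilon>: "\<epsilon> D i * \<epsilon> D i = 1" for D i by (simp add: \<epsilon>_def)
  have sumx: "(\<Sum>i\<in>A. (x D i)\<^sup>2) = 1" for D
  proof -
    have "(\<Sum>i\<in>A. (x D i)\<^sup>2) = (\<Sum>i\<in>I. (x D i)\<^sup>2)"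
      using fI A by (intro sum.mono_neutral_right) (auto simp: x_def)
    also have "\<dots> = (\<Sum>i\<in>I. 1 / p)"
      by (intro sum.cong) (auto simp: x_def \<epsilon>_def power_divide)
    also have "\<dots> = 1" using p by (simp add: p_def)
    finally show ?thesis .
  qed
  have c: "c D \<ge> 0" for D
  proof -
    have "\<bar>\<Prod>i\<in>I. \<epsilon> D i\<bar> = 1"
      unfolding abs_prod by (intro prod.neutral) (simp add: \<epsilon>_def)
    moreover have "\<bar>s\<bar> \<le> 1" by (simp add: s_def abs_sgn_eq)
    ultimately have "\<bar>s * (\<Prod>i\<in>I. \<epsilon> D i)\<bar> \<le> 1" by (simp add: abs_mult)
    then show ?thesis by (simp add: c_def)
  qed
  have sign: "(\<Sum>D\<in>Pow I. \<Prod>i\<in>B. \<epsilon> D i) = (if B = {} then 2 ^ p else 0)" if "B \<subseteq> I" for B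
    unfolding \<epsilon>_def p_def by (rule sum_Pow_prod_sign[OF fI(1) that])
  have sumc: "(\<Sum>D\<in>Pow I. c D) = 2 ^ p"
    using sign[of I] fI by (simp add: c_def sum.distrib sum_distrib_left[symmetric] card_Pow p_def)
  \<comment> \<open>A set \<open>J\<close> that leaves \<open>I\<close> meets a zero coordinate. For
    \<open>J\<close> inside \<open>I\<close> the tilt leaves the characters of \<open>J\<close> and
    of \<open>I - J\<close>; the first averages to 0 because \<open>J\<close> is nonempty, the
    second unless \<open>J = I\<close>.\<close>
  have mono: "(\<Sum>D\<in>Pow I. c D * (\<Prod>i\<in>J. x D i)) = (if J = I then 2 ^ p * (s * (1 / sqrt p) ^ p) else 0)"
    if J: "J \<in> K" for J
  proof (cases "J \<subseteq> I")
    case False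
    then obtain j where j: "j \<in> J" "j \<notin> I" by auto
    have "finite J" using J K A finite_subset[of J A] by auto
    then have "(\<Prod>i\<in>J. x D i) = 0" for D using j by (auto simp: x_def)
    then show ?thesis using False by auto
  next
    case True
    have fJ: "finite J" using True fI finite_subset by auto
    have px: "(\<Prod>i\<in>J. x D i) = (1 / sqrt p) ^ card J * (\<Prod>i\<in>J. \<epsilon> D i)" for D
    proof -
      have "(\<Prod>i\<in>J. x D i) = (\<Prod>i\<in>J. 1 / sqrt p * \<epsilon> D i)"
        using True by (intro prod.cong) (auto simp: x_def)
      also have "\<dots> = (\<Prod>i\<in>J. 1 / sqrt p) * (\<Prod>i\<in>J. \<epsilon> D i)" by (rule prod.distrib)
      finally show ?thesis by simp
    qed
    have pp: "(\<Prod>i\<in>I. \<epsilon> D i) * (\<Prod>i\<in>J. \<epsilon> D i) = (\<Prod>i\<in>I - J. \<epsilon> D i)" for D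
    proof -
      have "(\<Prod>i\<in>I. \<epsilon> D i) = (\<Prod>i\<in>I - J. \<epsilon> D i) * (\<Prod>i\<in>J. \<epsilon> D i)"
        by (rule prod.subset_diff) (use True fI in auto)
      moreover have "(\<Prod>i\<in>J. \<epsilon> D i) * (\<Prod>i\<in>J. \<epsilon> D i) = 1"
        by (simp add: prod.distrib[symmetric] \<epsilon>)
      ultimately show ?thesis by (simp add: mult.assoc)
    qed
    have "(\<Sum>D\<in>Pow I. c D * (\<Prod>i\<in>J. x D i))
        = (\<Sum>D\<in>Pow I. (1 / sqrt p) ^ card J * ((\<Prod>i\<in>J. \<epsilon> D i) + s * (\<Prod>i\<in>I - J. \<epsilon> D i)))"
      by (intro sum.cong) (auto simp: px c_def pp[symmetric] algebra_simps)
    also have "\<dots> = (1 / sqrt p) ^ card J * ((\<Sum>D\<in>Pow I. \<Prod>i\<in>J. \<epsilon> D i)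
        + s * (\<Sum>D\<in>Pow I. \<Prod>i\<in>I - J. \<epsilon> D i))"
      by (simp add: sum_distrib_left[symmetric] sum.distrib)
    also have "\<dots> = (if J = I then 2 ^ p * (s * (1 / sqrt p) ^ p) else 0)"
      using True K(2)[OF J] by (auto simp: sign p_def)
    finally show ?thesis .
  qed
  have "2 ^ p * (w I * s * (1 / sqrt p) ^ p)
      = (\<Sum>J\<in>K. w J * (if J = I then 2 ^ p * (s * (1 / sqrt p) ^ p) else 0))"
    using I fK by (simp add: if_distrib[of "\<lambda>t. _ * t"] sum.delta cong: if_cong)
  also have "\<dots> = (\<Sum>J\<in>K. w J * (\<Sum>D\<in>Pow I. c D * (\<Prod>i\<in>J. x D i)))"
    by (intro sum.cong) (auto simp: mono)
  also have "\<dots> = (\<Sum>D\<in>Pow I. c D * (\<Sum>J\<in>K. w J * (\<Prod>i\<in>J. x D i)))"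
    unfolding sum_distrib_left by (subst sum.swap) (simp add: mult_ac)
  also have "\<dots> \<le> (\<Sum>D\<in>Pow I. c D * G)"
    using c sumx by (intro sum_mono mult_left_mono ub) auto
  also have "\<dots> = 2 ^ p * G" by (simp add: sum_distrib_right[symmetric] sumc)
  finally have "w I * s * (1 / sqrt p) ^ p \<le> G" by simp
  moreover have "w I * s = \<bar>w I\<bar>" by (simp add: s_def abs_sgn)
  moreover have "(1 / sqrt p) ^ p = real p powr (- real p / 2)"
    using p by (simp add: powr_realpow[symmetric] powr_half_sqrt[symmetric] powr_divide powr_powr
        powr_minus_divide)
  ultimately show ?thesis by (simp add: p_def)
qed

section \<open>Reduction of the spin model to a multilinear form\<close>

definition interaction_sets :: "nat \<Rightarrow> nat set set" where
  "interaction_sets n = {I. I \<subseteq> {1..n} \<and> 2 \<le> card I}"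

lemma interaction_sets_subset_Pow: "interaction_sets n \<subseteq> Pow {1..n}"
  by (auto simp: interaction_sets_def)

lemma finite_interaction_sets [simp]: "finite (interaction_sets n)"
  by (rule finite_subset[OF interaction_sets_subset_Pow]) simp

lemma card_interaction_le: "I \<in> interaction_sets n \<Longrightarrow> card I \<le> n"
  using card_mono[of "{1..n}" I] by (simp add: interaction_sets_def)

lemma interaction_sets_nonempty: "n \<ge> 2 \<Longrightarrow> interaction_sets n \<noteq> {}"
  by (auto simp: interaction_sets_def intro!: exI[of _ "{1..n}"])

lemma sum_interaction_sets:
  "(\<Sum>p=2..n. \<Sum>I | I \<subseteq> {1..n} \<and> card I = p. f I) = (\<Sum>I\<in>interaction_sets n. f I)"
proof -
  have "(\<Sum>p=2..n. \<Sum>I | I \<subseteq> {1..n} \<and> card I = p. f I)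
      = (\<Sum>p=2..n. \<Sum>I | I \<in> interaction_sets n \<and> card I = p. f I)"
    by (intro sum.cong) (auto simp: interaction_sets_def)
  also have "\<dots> = (\<Sum>I\<in>interaction_sets n. f I)"
    using card_interaction_le by (intro sum.group) (auto simp: interaction_sets_def)
  finally show ?thesis .
qed

text \<open>The value \<open>undefined\<close> off \<open>{1..n}\<close> places the image in the
  extensional functions that make up \<open>spin_sphere\<close>.\<close>

definition rescale :: "nat \<Rightarrow> (nat \<Rightarrow> real) \<Rightarrow> nat \<Rightarrow> real" where
  "rescale n x = (\<lambda>i. if i \<in> {1..n} then sqrt (real n) * x i else undefined)"

text \<open>The p coordinates contribute n^(p/2) and the normalization n^(-(p-2)/2), so every size
  yields exactly one factor n.\<close>

lemma hamiltonian_rescale: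
  assumes "n > 0"
  shows "hamiltonian a n J (rescale n x)
    = n * (\<Sum>I\<in>interaction_sets n. a (card I) * J I * (\<Prod>i\<in>I. x i))"
proof -
  have "hamiltonian a n J (rescale n x) = (\<Sum>p=2..n. \<Sum>I | I \<subseteq> {1..n} \<and> card I = p.
      n * (a (card I) * J I * (\<Prod>i\<in>I. x i)))"
    unfolding hamiltonian_def sum_distrib_left
  proof (intro sum.cong refl)
    fix p I assume p: "p \<in> {2..n}" and I: "I \<in> {I. I \<subseteq> {1..n} \<and> card I = p}"
    have "(\<Prod>i\<in>I. rescale n x i) = (\<Prod>i\<in>I. sqrt n * x i)"
      using I by (intro prod.cong) (auto simp: rescale_def)
    also have "\<dots> = n powr (p / 2) * (\<Prod>i\<in>I. x i)"
      using I assms by (simp add: prod.distrib powr_half_sqrt[symmetric] powr_realpow[symmetric] powr_powr)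
    finally have "n powr (- (real p - 2) / 2) * (\<Prod>i\<in>I. rescale n x i)
        = n powr (- (real p - 2) / 2 + p / 2) * (\<Prod>i\<in>I. x i)"
      by (simp add: powr_add)
    also have "- (real p - 2) / 2 + p / 2 = 1" by (simp add: field_simps)
    finally show "a p * (J I * n powr (- (real p - 2) / 2) * (\<Prod>i\<in>I. rescale n x i))
        = n * (a (card I) * J I * (\<Prod>i\<in>I. x i))"
      using I assms by (simp add: mult_ac)
  qed
  also have "\<dots> = (\<Sum>I\<in>interaction_sets n. n * (a (card I) * J I * (\<Prod>i\<in>I. x i)))"
    by (rule sum_interaction_sets)
  finally show ?thesis by (simp add: sum_distrib_left)
qed

lemma spin_sphere_rescale:
  assumes "n > 0"
  shows "spin_sphere n = rescale n ` {x. (\<Sum>i=1..n. (x i)\<^sup>2) = 1}"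
proof (intro equalityI subsetI)
  fix \<sigma> assume \<sigma>: "\<sigma> \<in> spin_sphere n"
  show "\<sigma> \<in> rescale n ` {x. (\<Sum>i=1..n. (x i)\<^sup>2) = 1}"
  proof (rule image_eqI[of _ _ "\<lambda>i. \<sigma> i / sqrt n"])
    show "\<sigma> = rescale n (\<lambda>i. \<sigma> i / sqrt n)"
      using \<sigma> assms by (auto simp: spin_sphere_def extensional_def rescale_def)
    show "(\<lambda>i. \<sigma> i / sqrt n) \<in> {x. (\<Sum>i=1..n. (x i)\<^sup>2) = 1}"
      using \<sigma> assms by (simp add: spin_sphere_def power_divide sum_divide_distrib[symmetric])
  qed
next
  fix \<sigma> assume "\<sigma> \<in> rescale n ` {x. (\<Sum>i=1..n. (x i)\<^sup>2) = 1}"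
  then obtain x where x: "\<sigma> = rescale n x" "(\<Sum>i=1..n. (x i)\<^sup>2) = 1" by blast
  have "(\<Sum>i=1..n. (\<sigma> i)\<^sup>2) = (\<Sum>i=1..n. n * (x i)\<^sup>2)"
    by (intro sum.cong) (auto simp: x(1) rescale_def power_mult_distrib)
  also have "\<dots> = n" using x(2) by (simp add: sum_distrib_left[symmetric])
  finally show "\<sigma> \<in> spin_sphere n"
    by (auto simp: spin_sphere_def x(1) rescale_def extensional_def)
qed

lemma max_coupling_eq:
  "max_coupling a n J =
    Max ((\<lambda>I. \<bar>a (card I) * J I\<bar> * real (card I) powr (- real (card I) / 2)) ` interaction_sets n)"
proof -
  have "{\<bar>a p * J I\<bar> * real p powr (- real p / 2) | p I.
        2 \<le> p \<and> p \<le> n \<and> I \<subseteq> {1..n} \<and> card I = p}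
    = (\<lambda>I. \<bar>a (card I) * J I\<bar> * real (card I) powr (- real (card I) / 2)) ` interaction_sets n"
    (is "?L = ?f ` _")
  proof (intro equalityI subsetI)
    fix t assume "t \<in> ?L"
    then obtain p I where "t = \<bar>a p * J I\<bar> * real p powr (- real p / 2)" "2 \<le> p" "I \<subseteq> {1..n}" "card I = p"
      by blast
    then show "t \<in> ?f ` interaction_sets n" by (intro image_eqI[of _ _ I]) (auto simp: interaction_sets_def)
  next
    fix t assume "t \<in> ?f ` interaction_sets n"
    then obtain I where I: "I \<in> interaction_sets n" "t = ?f I" by blast
    then show "t \<in> ?L" using card_interaction_le[OF I(1)]
      by (intro CollectI exI[of _ "card I"] exI[of _ I]) (auto simp: interaction_sets_def)
  qed
  then show ?thesis by (simp add: max_coupling_def)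
qed

lemma max_coupling_le_ground_state_energy:
  assumes "n \<ge> 2"
  shows "max_coupling a n J \<le> ground_state_energy a n J / n"
proof -
  have ub: "(\<Sum>I\<in>interaction_sets n. a (card I) * J I * (\<Prod>i\<in>I. x i)) \<le> ground_state_energy a n J / n"
    if x: "(\<Sum>i\<in>{1..n}. (x i)\<^sup>2) = 1" for x
  proof -
    have "rescale n x \<in> spin_sphere n" using x assms by (simp add: spin_sphere_rescale)
    then have "hamiltonian a n J (rescale n x) \<le> ground_state_energy a n J"
      using ground_state_energy_attained[of n a J] by auto
    then show ?thesis using assms by (simp add: hamiltonian_rescale field_simps)
  qed
  have "\<bar>a (card I) * J I\<bar> * real (card I) powr (- real (card I) / 2) \<le> ground_state_energy a n J / n"
    if "I \<in> interaction_sets n" for I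
    by (rule multilinear_form_lower[where w = "\<lambda>I. a (card I) * J I", OF _ interaction_sets_subset_Pow _ that ub])
      (auto simp: interaction_sets_def)
  then show ?thesis unfolding max_coupling_eq
    using interaction_sets_nonempty[OF assms] by (intro Max.boundedI) auto
qed

text \<open>The family \<open>D\<close> is left free because it will be chosen separately for each
  outcome, as the sets carrying large couplings.\<close>

lemma ground_state_energy_le:
  assumes "n \<ge> 2" and D: "D \<subseteq> interaction_sets n" "pairwise disjnt D"
  shows "ground_state_energy a n J / n \<le>
    max_coupling a n J + sqrt (exp 1 * (\<Sum>I\<in>interaction_sets n - D. (a (card I) * J I)\<^sup>2))"
proof -
  obtain \<sigma> where \<sigma>: "\<sigma> \<in> spin_sphere n" "ground_state_energy a n J = hamiltonian a n J \<sigma>"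
    using ground_state_energy_attained by blast
  obtain x where x: "(\<Sum>i=1..n. (x i)\<^sup>2) = 1"
      "\<sigma> = rescale n x"
    using \<sigma>(1) assms spin_sphere_rescale[of n] by auto
  have le: "\<bar>a (card I) * J I\<bar> * real (card I) powr (- real (card I) / 2) \<le> max_coupling a n J"
    if "I \<in> interaction_sets n" for I
    unfolding max_coupling_eq using that by (intro Max_ge) auto
  have nonneg: "0 \<le> max_coupling a n J"
  proof -
    obtain I where "I \<in> interaction_sets n" using interaction_sets_nonempty[OF assms(1)] by auto
    then show ?thesis by (intro order_trans[OF _ le[of I]] mult_nonneg_nonneg) auto
  qed
  have "(\<Sum>I\<in>interaction_sets n. a (card I) * J I * (\<Prod>i\<in>I. x i)) \<le>
    max_coupling a n J + sqrt (exp 1 * (\<Sum>I\<in>interaction_sets n - D. (a (card I) * J I)\<^sup>2))"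
  proof (rule multilinear_form_upper[where w = "\<lambda>I. a (card I) * J I",
        OF _ x(1) interaction_sets_subset_Pow _ D nonneg])
    show "2 \<le> card I" if "I \<in> interaction_sets n" for I
      using that by (simp add: interaction_sets_def)
    show "\<bar>a (card I) * J I\<bar> * real (card I) powr (- real (card I) / 2) \<le> max_coupling a n J"
      if "I \<in> D" for I
      using that D(1) by (intro le) auto
  qed simp
  then show ?thesis using assms by (simp add: \<sigma>(2) x(2) hamiltonian_rescale)
qed

section \<open>Measurability, counting and truncated second moments\<close>

text \<open>By continuity of the Hamiltonian a dense subset of the sphere suffices. One countable
  \<open>T\<close> serves all couplings \<open>J\<close> simultaneously, which turns the ground
  state energy into a countable supremum of measurable functions.\<close>

lemma ground_state_energy_dense:
  assumes T: "T \<subseteq> spin_sphere n" "spin_sphere n \<subseteq> closure T"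
  shows "ground_state_energy a n J = (SUP \<sigma>\<in>T. hamiltonian a n J \<sigma>)"
    and "bdd_above (hamiltonian a n J ` T)"
proof -
  obtain \<sigma> where \<sigma>: "\<sigma> \<in> spin_sphere n" "ground_state_energy a n J = hamiltonian a n J \<sigma>"
      "\<And>\<tau>. \<tau> \<in> spin_sphere n \<Longrightarrow> hamiltonian a n J \<tau> \<le> hamiltonian a n J \<sigma>"
    using ground_state_energy_attained by blast
  have le: "hamiltonian a n J \<tau> \<le> hamiltonian a n J \<sigma>" if "\<tau> \<in> T" for \<tau>
    using \<sigma>(3) T(1) that by blast
  show bdd: "bdd_above (hamiltonian a n J ` T)" using le by (auto intro!: bdd_aboveI)
  have ne: "T \<noteq> {}" using T(2) spin_sphere_nonempty[of n] by auto
  have "closed {\<tau>. hamiltonian a n J \<tau> \<le> (SUP \<sigma>\<in>T. hamiltonian a n J \<sigma>)}"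
    by (intro closed_Collect_le continuous_on_hamiltonian continuous_intros)
  moreover have "T \<subseteq> {\<tau>. hamiltonian a n J \<tau> \<le> (SUP \<sigma>\<in>T. hamiltonian a n J \<sigma>)}"
    using bdd by (auto intro: cSUP_upper)
  ultimately have "closure T \<subseteq> {\<tau>. hamiltonian a n J \<tau> \<le> (SUP \<sigma>\<in>T. hamiltonian a n J \<sigma>)}"
    by (intro closure_minimal)
  then have "hamiltonian a n J \<sigma> \<le> (SUP \<sigma>\<in>T. hamiltonian a n J \<sigma>)"
    using \<sigma>(1) T(2) by blast
  moreover have "(SUP \<sigma>\<in>T. hamiltonian a n J \<sigma>) \<le> hamiltonian a n J \<sigma>"
    using ne le by (intro cSUP_least)
  ultimately show "ground_state_energy a n J = (SUP \<sigma>\<in>T. hamiltonian a n J \<sigma>)"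
    using \<sigma>(2) by simp
qed

lemma measurable_ground_state_energy:
  assumes "\<And>I. I \<in> interaction_sets n \<Longrightarrow> X I \<in> borel_measurable M"
  shows "(\<lambda>\<omega>. ground_state_energy a n (\<lambda>I. X I \<omega>)) \<in> borel_measurable M"
proof -
  obtain T where T: "countable T" "T \<subseteq> spin_sphere n" "spin_sphere n \<subseteq> closure T"
    by (rule separable)
  have "(\<lambda>\<omega>. hamiltonian a n (\<lambda>I. X I \<omega>) \<sigma>) \<in> borel_measurable M" for \<sigma>
    unfolding hamiltonian_def using assms
    by (intro borel_measurable_sum borel_measurable_times borel_measurable_const)
      (auto simp: interaction_sets_def)
  then show ?thesis
    unfolding ground_state_energy_dense(1)[OF T(2,3)]
    by (intro borel_measurable_cSUP T(1) ground_state_energy_dense(2)[OF T(2,3)])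
qed

lemma measurable_max_coupling:
  assumes "\<And>I. I \<in> interaction_sets n \<Longrightarrow> X I \<in> borel_measurable M"
  shows "(\<lambda>\<omega>. max_coupling a n (\<lambda>I. X I \<omega>)) \<in> borel_measurable M"
  unfolding max_coupling_eq using assms
  by (intro borel_measurable_Max borel_measurable_times borel_measurable_const borel_measurable_abs) auto

section \<open>Counting sets by size\<close>

lemma sum_interaction_sets_binomial:
  "(\<Sum>I\<in>interaction_sets n. f (card I) / real (n choose card I)) = (\<Sum>p=2..n. f p)"
  for f :: "nat \<Rightarrow> real"
  unfolding sum_interaction_sets[symmetric]
  by (intro sum.cong) (auto simp: n_subsets)

text \<open>Removing \<open>i\<close> is a bijection onto the subsets of size \<open>p - 1\<close>
  of the remaining points; the absorption identity for binomials then turns their number into the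
  fraction p / \<open>card A\<close> of all sets of size p.\<close>

lemma card_subsets_containing:
  assumes "finite A" "i \<in> A" "p \<ge> 1"
  shows "real (card {I. I \<subseteq> A \<and> i \<in> I \<and> card I = p}) = real p / real (card A) * real (card A choose p)"
proof -
  have "bij_betw (insert i) {I. I \<subseteq> A - {i} \<and> card I = p - 1} {I. I \<subseteq> A \<and> i \<in> I \<and> card I = p}"
  proof (rule bij_betw_byWitness[where f' = "\<lambda>I. I - {i}"])
    show "insert i ` {I. I \<subseteq> A - {i} \<and> card I = p - 1} \<subseteq> {I. I \<subseteq> A \<and> i \<in> I \<and> card I = p}"
      using assms by (auto simp: card_insert_if finite_subset)
    show "(\<lambda>I. I - {i}) ` {I. I \<subseteq> A \<and> i \<in> I \<and> card I = p} \<subseteq> {I. I \<subseteq> A - {i} \<and> card I = p - 1}"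
      using assms by (auto simp: card_Diff_singleton finite_subset)
  qed auto
  then have "card {I. I \<subseteq> A \<and> i \<in> I \<and> card I = p} = card (A - {i}) choose (p - 1)"
    using assms n_subsets[of "A - {i}" "p - 1"] by (simp add: bij_betw_same_card)
  also have "card (A - {i}) = card A - 1" using assms by simp
  finally have "card A * card {I. I \<subseteq> A \<and> i \<in> I \<and> card I = p} = p * (card A choose p)"
    using times_binomial_minus1_eq[of p "card A"] assms by simp
  then have "real (card A) * real (card {I. I \<subseteq> A \<and> i \<in> I \<and> card I = p}) = real p * real (card A choose p)"
    by (simp flip: of_nat_mult)
  moreover have "card A > 0" using assms by (auto simp: card_gt_0_iff)
  ultimately show ?thesis by (simp add: field_simps)
qed

text \<open>A given point lies in a fraction p / n of the sets of size p. This gain of 1 / n makes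
  it unlikely that two large sets share a point.\<close>

lemma sum_interaction_sets_containing:
  fixes f :: "nat \<Rightarrow> real"
  assumes "i \<in> {1..n}"
  shows "(\<Sum>I | I \<in> interaction_sets n \<and> i \<in> I. f (card I) / real (n choose card I))
    = (\<Sum>p=2..n. f p * p / n)"
proof -
  have "(\<Sum>I | I \<in> interaction_sets n \<and> i \<in> I. f (card I) / real (n choose card I))
      = (\<Sum>I\<in>interaction_sets n. if i \<in> I then f (card I) / real (n choose card I) else 0)"
    by (rule sum.inter_filter) simp
  also have "\<dots> = (\<Sum>p=2..n. \<Sum>I | I \<subseteq> {1..n} \<and> card I = p. if i \<in> I then f p / real (n choose p) else 0)"
    unfolding sum_interaction_sets[symmetric] by (intro sum.cong) auto
  also have "\<dots> = (\<Sum>p=2..n. f p * p / n)"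
  proof (rule sum.cong)
    fix p assume p: "p \<in> {2..n}"
    have "(\<Sum>I | I \<subseteq> {1..n} \<and> card I = p. if i \<in> I then f p / real (n choose p) else 0)
        = (\<Sum>I | I \<in> {I. I \<subseteq> {1..n} \<and> card I = p} \<and> i \<in> I. f p / real (n choose p))"
      by (rule sum.inter_filter[symmetric]) simp
    also have "\<dots> = real (card {I. I \<subseteq> {1..n} \<and> i \<in> I \<and> card I = p}) * (f p / real (n choose p))"
      by (simp add: conj_ac)
    also have "\<dots> = f p * p / n"
      using p assms card_subsets_containing[of "{1..n}" i p] by simp
    finally show "(\<Sum>I | I \<subseteq> {1..n} \<and> card I = p. if i \<in> I then f p / real (n choose p) else 0) = f p * p / n" .
  qed simp
  finally show ?thesis .
qed

section \<open>Truncated second moments\<close>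

definition sq_below :: "real \<Rightarrow> real \<Rightarrow> real" where
  "sq_below r y = (if \<bar>y\<bar> \<le> r then y\<^sup>2 else 0)"

lemma sq_below_nonneg [simp]: "0 \<le> sq_below r y" by (simp add: sq_below_def)

lemma sq_below_le: "sq_below r y \<le> r\<^sup>2"
  using abs_le_square_iff[of y r] by (auto simp: sq_below_def)

lemma measurable_sq_below [measurable]: "sq_below r \<in> borel_measurable borel"
  unfolding sq_below_def by measurable

context prob_space
begin

lemma integrable_sq_below [simp]:
  "X \<in> borel_measurable M \<Longrightarrow> integrable M (\<lambda>\<omega>. sq_below r (X \<omega>))"
  using sq_below_le[of r] by (intro integrable_const_bound[where B = "r\<^sup>2"]) auto

text \<open>Values between \<open>s\<close> and \<open>r\<close> contribute at most
  \<open>r\<^sup>2\<close> times the tail at \<open>s\<close>; smaller ones are already counted by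
  the truncation at \<open>s\<close>.\<close>

lemma expectation_sq_below_step:
  assumes [measurable]: "X \<in> borel_measurable M" and "s \<le> r"
  shows "expectation (\<lambda>\<omega>. sq_below r (X \<omega>))
    \<le> r\<^sup>2 * prob {\<omega> \<in> space M. \<bar>X \<omega>\<bar> > s} + expectation (\<lambda>\<omega>. sq_below s (X \<omega>))"
proof -
  have "expectation (\<lambda>\<omega>. sq_below r (X \<omega>))
      \<le> expectation (\<lambda>\<omega>. r\<^sup>2 * indicator {\<omega> \<in> space M. \<bar>X \<omega>\<bar> > s} \<omega> + sq_below s (X \<omega>))"
  proof (intro integral_mono integrable_add integrable_mult_right)
    fix \<omega> assume "\<omega> \<in> space M"
    then show "sq_below r (X \<omega>) \<le> r\<^sup>2 * indicator {\<omega> \<in> space M. \<bar>X \<omega>\<bar> > s} \<omega> + sq_below s (X \<omega>)"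
      using sq_below_le[of r "X \<omega>"] by (cases "\<bar>X \<omega>\<bar> > s") (auto simp: sq_below_def)
  qed (auto simp: emeasure_eq_measure)
  also have "\<dots> = r\<^sup>2 * prob {\<omega> \<in> space M. \<bar>X \<omega>\<bar> > s} + expectation (\<lambda>\<omega>. sq_below s (X \<omega>))"
    by (subst Bochner_Integration.integral_add) (auto simp: emeasure_eq_measure)
  finally show ?thesis .
qed

text \<open>The constant \<open>c\<close> solves \<open>2 powr \<beta> + c * 2 powr (\<beta> - 2) = c\<close>, the fixed point equation of one
  dyadic step.\<close>
lemma expectation_sq_below_small:
  assumes [measurable]: "X \<in> borel_measurable M" and "\<beta> < 2" "0 \<le> K"
    and tail: "\<And>u. 0 < u \<Longrightarrow> u \<le> 1 \<Longrightarrow> prob {\<omega> \<in> space M. \<bar>X \<omega>\<bar> > u} \<le> K * u powr (- \<beta>)"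
    and "0 < \<tau>" "\<tau> \<le> 1"
  shows "expectation (\<lambda>\<omega>. sq_below \<tau> (X \<omega>))
    \<le> 2 powr \<beta> / (1 - 2 powr (\<beta> - 2)) * K * \<tau> powr (2 - \<beta>)"
proof -
  define c where "c = 2 powr \<beta> / (1 - 2 powr (\<beta> - 2))"
  define e where "e r = expectation (\<lambda>\<omega>. sq_below r (X \<omega>))" for r
  have lt: "2 powr (\<beta> - 2) < 1" using powr_less_mono[of "\<beta> - 2" 0 2] assms by simp
  have "A + A / (1 - q) * q = A / (1 - q)" if "q < 1" for A q :: real
    using that by (simp add: divide_simps) (simp add: algebra_simps)
  with lt have c: "2 powr \<beta> + c * 2 powr (\<beta> - 2) = c" "c \<ge> 0" by (auto simp: c_def)
  \<comment> \<open>The excess of \<open>e r\<close> over the claimed bound does not decrease when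
    \<open>r\<close> is halved, and it is at most \<open>r\<^sup>2\<close>. Repeated halving
    therefore shows that it is at most 0.\<close>
  have step: "e r - c * K * r powr (2 - \<beta>) \<le> e (r / 2) - c * K * (r / 2) powr (2 - \<beta>)"
    if r: "0 < r" "r \<le> 1" for r
  proof -
    have "e r \<le> r\<^sup>2 * prob {\<omega> \<in> space M. \<bar>X \<omega>\<bar> > r / 2} + e (r / 2)"
      unfolding e_def using r by (intro expectation_sq_below_step) auto
    also have "\<dots> \<le> r\<^sup>2 * (K * (r / 2) powr (- \<beta>)) + e (r / 2)"
      using r by (intro add_right_mono mult_left_mono tail) auto
    also have "r\<^sup>2 * (K * (r / 2) powr (- \<beta>)) = K * 2 powr \<beta> * r powr (2 - \<beta>)"
      using r by (simp add: powr_divide powr_minus powr_diff powr_numeral field_simps)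
    also have "K * 2 powr \<beta> * r powr (2 - \<beta>)
        = K * c * r powr (2 - \<beta>) - K * c * (2 powr (\<beta> - 2) * r powr (2 - \<beta>))"
      using c(1) by (metis (no_types, opaque_lifting) add_diff_cancel_right' left_diff_distrib mult.assoc right_diff_distrib)
    also have "2 powr (\<beta> - 2) * r powr (2 - \<beta>) = (r / 2) powr (2 - \<beta>)"
      using r by (simp add: powr_divide powr_diff field_simps)
    finally show ?thesis by (simp add: mult_ac)
  qed
  have iter: "e \<tau> - c * K * \<tau> powr (2 - \<beta>) \<le> e (\<tau> / 2 ^ m) - c * K * (\<tau> / 2 ^ m) powr (2 - \<beta>)" for m
  proof (induction m)
    case (Suc m)
    have "\<tau> / 2 ^ m \<le> 1" using assms by (simp add: divide_le_eq_1 order_trans[OF _ one_le_power])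
    then show ?case using Suc step[of "\<tau> / 2 ^ m"] assms by (simp add: mult_ac)
  qed simp
  have bound: "e \<tau> - c * K * \<tau> powr (2 - \<beta>) \<le> (\<tau> / 2 ^ m)\<^sup>2" for m
  proof -
    have "e (\<tau> / 2 ^ m) \<le> expectation (\<lambda>_. (\<tau> / 2 ^ m)\<^sup>2)"
      unfolding e_def by (intro integral_mono sq_below_le) auto
    moreover have "0 \<le> c * K * (\<tau> / 2 ^ m) powr (2 - \<beta>)" using c assms by auto
    ultimately show ?thesis using iter[of m] by (simp add: prob_space)
  qed
  have "(\<lambda>m. (\<tau> * (1 / 2) ^ m)\<^sup>2) \<longlonglongrightarrow> (\<tau> * 0)\<^sup>2"
    by (intro tendsto_intros LIMSEQ_power_zero) auto
  then have "(\<lambda>m. (\<tau> / 2 ^ m)\<^sup>2) \<longlonglongrightarrow> 0"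
    by (simp add: power_one_over)
  from LIMSEQ_le_const[OF this] bound have "e \<tau> - c * K * \<tau> powr (2 - \<beta>) \<le> 0" by blast
  then show ?thesis by (simp add: e_def c_def)
qed

lemma prob_UN_le:
  assumes "finite I" "\<And>i. i \<in> I \<Longrightarrow> A i \<in> events" "\<And>i. i \<in> I \<Longrightarrow> prob (A i) \<le> f i"
  shows "prob (\<Union>i\<in>I. A i) \<le> (\<Sum>i\<in>I. f i)"
proof -
  have "prob (\<Union>i\<in>I. A i) \<le> (\<Sum>i\<in>I. prob (A i))"
    using assms(1,2) by (intro finite_measure_subadditive_finite) auto
  also have "\<dots> \<le> (\<Sum>i\<in>I. f i)" by (intro sum_mono assms(3))
  finally show ?thesis .
qed

end

section \<open>Concentration of the ground state energy\<close>

lemma sum_initial_le_square: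
  assumes "P \<ge> 0"
  shows "(\<Sum>p=2..n. if real p \<le> P then real p else 0) \<le> P\<^sup>2"
proof -
  have "(\<Sum>p=2..n. if real p \<le> P then real p else 0) = (\<Sum>p | p \<in> {2..n} \<and> real p \<le> P. real p)"
    by (rule sum.inter_filter[symmetric]) simp
  also have "\<dots> \<le> (\<Sum>p | p \<in> {2..n} \<and> real p \<le> P. P)" by (intro sum_mono) auto
  also have "\<dots> = card {p \<in> {2..n}. real p \<le> P} * P" by simp
  also have "real (card {p \<in> {2..n}. real p \<le> P}) \<le> P"
  proof -
    have "{p \<in> {2..n}. real p \<le> P} \<subseteq> {1..nat \<lfloor>P\<rfloor>}" by (auto simp: le_nat_floor)
    then have "card {p \<in> {2..n}. real p \<le> P} \<le> nat \<lfloor>P\<rfloor>"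
      using card_mono[of "{1..nat \<lfloor>P\<rfloor>}"] by simp
    then show ?thesis using assms by linarith
  qed
  finally show ?thesis using assms by (simp add: power2_eq_square mult_right_mono)
qed

text \<open>The three failure terms belong to three events: \<open>B\<^sub>1\<close>, the truncated
  sum of squares reaches \<open>s\<close> (Markov); \<open>B\<^sub>2\<close>, some coupling exceeds
  \<open>U\<close> (union bound); \<open>B\<^sub>3\<close>, two distinct sets of size at most
  \<open>P\<close> with couplings above \<open>\<tau>\<close> share a point (union over the point,
  independence of pairs). Outside them the deterministic bounds apply to the sets above their
  threshold.\<close>

lemma (in prob_space) ground_state_energy_concentration:
  fixes X :: "nat set \<Rightarrow> 'a \<Rightarrow> real"
  assumes n: "n \<ge> 2"
    and X: "\<And>I. I \<in> interaction_sets n \<Longrightarrow> X I \<in> borel_measurable M"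
    and indep: "\<And>I I' u. I \<in> interaction_sets n \<Longrightarrow> I' \<in> interaction_sets n \<Longrightarrow> I \<noteq> I' \<Longrightarrow>
        prob {\<omega> \<in> space M. \<bar>X I \<omega>\<bar> > u \<and> \<bar>X I' \<omega>\<bar> > u}
          = prob {\<omega> \<in> space M. \<bar>X I \<omega>\<bar> > u} * prob {\<omega> \<in> space M. \<bar>X I' \<omega>\<bar> > u}"
    and tail0: "\<And>I u. I \<in> interaction_sets n \<Longrightarrow> 0 < u \<Longrightarrow> u \<le> 1 \<Longrightarrow>
        prob {\<omega> \<in> space M. \<bar>X I \<omega>\<bar> > u} \<le> C * u powr (- \<beta>) / real (n choose card I)"
    and tail1: "\<And>I u. I \<in> interaction_sets n \<Longrightarrow> 1 \<le> u \<Longrightarrow>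
        prob {\<omega> \<in> space M. \<bar>X I \<omega>\<bar> > u} \<le> C * u powr (- \<gamma>) / real (n choose card I)"
    and C: "C \<ge> 0" and \<beta>: "\<beta> < 2"
    and \<tau>: "0 < \<tau>" "\<tau> \<le> 1" and U: "1 \<le> U" and P: "0 \<le> P" and s: "0 < s"
  defines "c \<equiv> 2 powr \<beta> / (1 - 2 powr (\<beta> - 2))"
  shows "prob {\<omega> \<in> space M. \<bar>ground_state_energy a n (\<lambda>I. X I \<omega>) / n - max_coupling a n (\<lambda>I. X I \<omega>)\<bar>
      \<le> sqrt (exp 1 * s)}
    \<ge> 1 - ((\<Sum>p=2..n. (a p)\<^sup>2 * (if real p \<le> P then c * C * \<tau> powr (2 - \<beta>) else (c + 1) * C * U\<^sup>2)) / s
        + n * C * U powr (- \<gamma>) + (C * \<tau> powr (- \<beta>) * P\<^sup>2)\<^sup>2 / n)"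
proof -
  define K where "K = interaction_sets n"
  \<comment> \<open>Sets larger than \<open>P\<close> get the high threshold \<open>U\<close>, which
    none of them exceeds outside \<open>B\<^sub>2\<close>; hence every set above its threshold has
    size at most \<open>P\<close>.\<close>
  define \<theta> where "\<theta> I = (if real (card I) \<le> P then \<tau> else U)" for I :: "nat set"
  define big where "big I u = {\<omega> \<in> space M. \<bar>X I \<omega>\<bar> > u}" for I u
  have fK: "finite K" by (simp add: K_def)
  have XK: "X I \<in> borel_measurable M" if "I \<in> K" for I using X that by (simp add: K_def)
  have big[measurable]: "big I u \<in> events" if "I \<in> K" for I u
    using XK[OF that] unfolding big_def by measurable
  have \<theta>0: "0 < \<theta> I" for I using \<tau> U by (auto simp: \<theta>_def)
  have c0: "0 \<le> c"
    using powr_less_mono[of "\<beta> - 2" 0 2] \<beta> by (simp add: c_def)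

  have trunc: "expectation (\<lambda>\<omega>. sq_below (\<theta> I) (X I \<omega>))
      \<le> (if real (card I) \<le> P then c * C * \<tau> powr (2 - \<beta>) else (c + 1) * C * U\<^sup>2) / real (n choose card I)"
    if I: "I \<in> K" for I
  proof -
    let ?N = "real (n choose card I)"
    have small: "expectation (\<lambda>\<omega>. sq_below u (X I \<omega>)) \<le> c * (C / ?N) * u powr (2 - \<beta>)"
      if "0 < u" "u \<le> 1" for u
      unfolding c_def
      using tail0[of I] I XK[OF I] C \<beta> that by (intro expectation_sq_below_small) (auto simp: K_def)
    show ?thesis
    proof (cases "real (card I) \<le> P")
      case True
      then show ?thesis using small[OF \<tau>] by (simp add: \<theta>_def)
    next
      case False
      \<comment> \<open>The bound \<open>tail0\<close> stops at 1, so the range up to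
        \<open>U\<close> is estimated crudely by \<open>U\<^sup>2\<close>. This loss is affordable
        because it occurs only for large sets, whose coefficients are tiny.\<close>
      have "expectation (\<lambda>\<omega>. sq_below U (X I \<omega>))
          \<le> U\<^sup>2 * prob (big I 1) + expectation (\<lambda>\<omega>. sq_below 1 (X I \<omega>))"
        unfolding big_def by (rule expectation_sq_below_step[OF XK[OF I] U])
      also have "\<dots> \<le> U\<^sup>2 * (C / ?N) + c * (C / ?N) * 1"
        using small[of 1] tail0[of I 1] I
        by (intro add_mono mult_left_mono) (auto simp: big_def K_def)
      also have "\<dots> \<le> U\<^sup>2 * (C / ?N) + c * (C / ?N) * U\<^sup>2"
        using U c0 C by (intro add_left_mono mult_left_mono) auto
      also have "\<dots> = (c + 1) * C * U\<^sup>2 / ?N" by (simp add: add_divide_distrib algebra_simps)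
      finally show ?thesis using False by (simp add: \<theta>_def)
    qed
  qed
  define S where "S \<omega> = (\<Sum>I\<in>K. (a (card I))\<^sup>2 * sq_below (\<theta> I) (X I \<omega>))" for \<omega>
  have S_int: "integrable M S"
    unfolding S_def by (intro Bochner_Integration.integrable_sum integrable_mult_right integrable_sq_below XK)
  have S0: "0 \<le> S \<omega>" for \<omega> unfolding S_def by (intro sum_nonneg) auto
  define e where "e p = (a p)\<^sup>2 * (if real p \<le> P then c * C * \<tau> powr (2 - \<beta>) else (c + 1) * C * U\<^sup>2)" for p
  have ES: "expectation S \<le> (\<Sum>p=2..n. e p)"
  proof -
    have "expectation S = (\<Sum>I\<in>K. (a (card I))\<^sup>2 * expectation (\<lambda>\<omega>. sq_below (\<theta> I) (X I \<omega>)))"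
      unfolding S_def
      by (subst Bochner_Integration.integral_sum) (auto intro!: integrable_mult_right integrable_sq_below XK)
    also have "\<dots> \<le> (\<Sum>I\<in>K. (a (card I))\<^sup>2 * ((if real (card I) \<le> P then c * C * \<tau> powr (2 - \<beta>)
        else (c + 1) * C * U\<^sup>2) / real (n choose card I)))"
      by (intro sum_mono mult_left_mono trunc) auto
    also have "\<dots> = (\<Sum>I\<in>K. e (card I) / real (n choose card I))" by (simp add: e_def)
    also have "\<dots> = (\<Sum>p=2..n. e p)" unfolding K_def by (rule sum_interaction_sets_binomial)
    finally show ?thesis .
  qed
  define B\<^sub>1 where "B\<^sub>1 = {\<omega> \<in> space M. S \<omega> \<ge> s}"
  have B1: "B\<^sub>1 \<in> events"
    using borel_measurable_integrable[OF S_int] unfolding B\<^sub>1_def by measurable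
  have P1: "prob B\<^sub>1 \<le> (\<Sum>p=2..n. e p) / s"
  proof -
    have "prob B\<^sub>1 \<le> expectation S / s"
      unfolding B\<^sub>1_def using S0 s by (intro integral_Markov_inequality_measure[OF S_int, where A = "{}"]) auto
    then show ?thesis using ES s by (meson divide_right_mono less_imp_le order_trans)
  qed

  define B\<^sub>2 where "B\<^sub>2 = (\<Union>I\<in>K. big I U)"
  have B2: "B\<^sub>2 \<in> events" unfolding B\<^sub>2_def using fK big by (intro sets.finite_UN) auto
  have P2: "prob B\<^sub>2 \<le> n * C * U powr (- \<gamma>)"
  proof -
    have "prob B\<^sub>2 \<le> (\<Sum>I\<in>K. C * U powr (- \<gamma>) / real (n choose card I))"
      unfolding B\<^sub>2_def
    proof (rule prob_UN_le[OF fK])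
      fix I assume I: "I \<in> K"
      show "big I U \<in> events" by (rule big[OF I])
      show "prob (big I U) \<le> C * U powr (- \<gamma>) / real (n choose card I)"
        using tail1[of I U] I U by (simp add: big_def K_def)
    qed
    also have "\<dots> = (\<Sum>p=2..n. C * U powr (- \<gamma>))"
      unfolding K_def by (rule sum_interaction_sets_binomial)
    also have "\<dots> = real (n - 1) * (C * U powr (- \<gamma>))" by simp
    also have "\<dots> \<le> real n * (C * U powr (- \<gamma>))" using C by (intro mult_right_mono) auto
    finally show ?thesis by (simp add: mult.assoc)
  qed

  define R where "R i = {I \<in> K. i \<in> I \<and> real (card I) \<le> P}" for i
  define B\<^sub>3 where "B\<^sub>3 = (\<Union>i\<in>{1..n}. \<Union>(I, I')\<in>{(I, I'). I \<in> R i \<and> I' \<in> R i \<and> I \<noteq> I'}. big I \<tau> \<inter> big I' \<tau>)"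
  have fR: "finite {(I, I'). I \<in> R i \<and> I' \<in> R i \<and> I \<noteq> I'}" for i
    by (rule finite_subset[of _ "K \<times> K"]) (auto simp: R_def fK)
  have B3i: "(\<Union>(I, I')\<in>{(I, I'). I \<in> R i \<and> I' \<in> R i \<and> I \<noteq> I'}. big I \<tau> \<inter> big I' \<tau>) \<in> events" for i
    using fR by (intro sets.finite_UN) (auto simp: R_def intro!: big)
  have B3: "B\<^sub>3 \<in> events" unfolding B\<^sub>3_def by (rule sets.finite_UN[OF _ B3i]) simp
  have P3: "prob B\<^sub>3 \<le> (C * \<tau> powr (- \<beta>) * P\<^sup>2)\<^sup>2 / n"
  proof -
    define q where "q i = (\<Sum>I\<in>R i. prob (big I \<tau>))" for i
    have q: "q i \<le> C * \<tau> powr (- \<beta>) * P\<^sup>2 / n" if i: "i \<in> {1..n}" for i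
    proof -
      let ?f = "\<lambda>p::nat. if real p \<le> P then C * \<tau> powr (- \<beta>) else 0"
      have "q i \<le> (\<Sum>I\<in>R i. C * \<tau> powr (- \<beta>) / real (n choose card I))"
        unfolding q_def using tail0 \<tau> by (intro sum_mono) (auto simp: big_def R_def K_def)
      also have "\<dots> = (\<Sum>I\<in>R i. ?f (card I) / real (n choose card I))"
        by (intro sum.cong) (auto simp: R_def)
      also have "\<dots> = (\<Sum>I | I \<in> interaction_sets n \<and> i \<in> I. ?f (card I) / real (n choose card I))"
        by (intro sum.mono_neutral_left) (auto simp: R_def K_def)
      also have "\<dots> = (\<Sum>p=2..n. ?f p * p / n)" by (rule sum_interaction_sets_containing[OF i])
      also have "\<dots> = C * \<tau> powr (- \<beta>) / n * (\<Sum>p=2..n. if real p \<le> P then real p else 0)"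
        unfolding sum_distrib_left by (intro sum.cong) auto
      also have "\<dots> \<le> C * \<tau> powr (- \<beta>) / n * P\<^sup>2"
        using C P by (intro mult_left_mono sum_initial_le_square) auto
      finally show ?thesis by simp
    qed
    have "prob B\<^sub>3 \<le> (\<Sum>i\<in>{1..n}. (C * \<tau> powr (- \<beta>) * P\<^sup>2 / n)\<^sup>2)"
      unfolding B\<^sub>3_def
    proof (rule prob_UN_le)
      fix i assume i: "i \<in> {1..n}"
      let ?R = "{(I, I'). I \<in> R i \<and> I' \<in> R i \<and> I \<noteq> I'}"
      have fRi: "finite (R i)" by (simp add: R_def fK)
      have "prob (\<Union>(I, I')\<in>?R. big I \<tau> \<inter> big I' \<tau>)
          \<le> (\<Sum>(I, I')\<in>?R. prob (big I \<tau>) * prob (big I' \<tau>))"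
      proof (rule prob_UN_le[OF fR])
        fix z assume "z \<in> ?R"
        then obtain I I' where z: "z = (I, I')" "I \<in> K" "I' \<in> K" "I \<noteq> I'" by (auto simp: R_def)
        have "big I \<tau> \<inter> big I' \<tau> = {\<omega> \<in> space M. \<bar>X I \<omega>\<bar> > \<tau> \<and> \<bar>X I' \<omega>\<bar> > \<tau>}"
          by (auto simp: big_def)
        then show "prob (case z of (I, I') \<Rightarrow> big I \<tau> \<inter> big I' \<tau>)
            \<le> (case z of (I, I') \<Rightarrow> prob (big I \<tau>) * prob (big I' \<tau>))"
          using indep[of I I' \<tau>] z by (simp add: big_def K_def)
        show "(case z of (I, I') \<Rightarrow> big I \<tau> \<inter> big I' \<tau>) \<in> events" using z big by auto
      qed
      \<comment> \<open>Adding the diagonal pairs completes the sum to a square. Each point then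
        costs order 1 / n^2, and the n points together order 1 / n.\<close>
      also have "\<dots> \<le> (\<Sum>(I, I')\<in>R i \<times> R i. prob (big I \<tau>) * prob (big I' \<tau>))"
        using fRi by (intro sum_mono2) auto
      also have "\<dots> = (q i)\<^sup>2"
        by (simp add: q_def power2_eq_square sum_product sum.cartesian_product)
      also have "\<dots> \<le> (C * \<tau> powr (- \<beta>) * P\<^sup>2 / n)\<^sup>2"
        using q[OF i] by (intro power_mono) (auto simp: q_def sum_nonneg)
      finally show "prob (\<Union>(I, I')\<in>?R. big I \<tau> \<inter> big I' \<tau>) \<le> (C * \<tau> powr (- \<beta>) * P\<^sup>2 / n)\<^sup>2" .
    qed (use B3i in auto)
    also have "\<dots> = (C * \<tau> powr (- \<beta>) * P\<^sup>2)\<^sup>2 / n"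
      using n by (simp add: power_divide power2_eq_square)
    finally show ?thesis .
  qed

  let ?G = "{\<omega> \<in> space M. \<bar>ground_state_energy a n (\<lambda>I. X I \<omega>) / n - max_coupling a n (\<lambda>I. X I \<omega>)\<bar>
      \<le> sqrt (exp 1 * s)}"
  have G: "?G \<in> events"
    using measurable_ground_state_energy[of n X M a] measurable_max_coupling[of n X M a] X
    by measurable
  have sub: "space M - (B\<^sub>1 \<union> B\<^sub>2 \<union> B\<^sub>3) \<subseteq> ?G"
  proof
    fix \<omega> assume \<omega>: "\<omega> \<in> space M - (B\<^sub>1 \<union> B\<^sub>2 \<union> B\<^sub>3)"
    define D where "D = {I \<in> K. \<bar>X I \<omega>\<bar> > \<theta> I}"
    have DP: "real (card I) \<le> P" "\<omega> \<in> big I \<tau>" if "I \<in> D" for I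
    proof -
      show *: "real (card I) \<le> P"
      proof (rule ccontr)
        assume "\<not> real (card I) \<le> P"
        then have "\<omega> \<in> B\<^sub>2" using that \<omega> by (auto simp: D_def \<theta>_def B\<^sub>2_def big_def)
        then show False using \<omega> by auto
      qed
      show "\<omega> \<in> big I \<tau>" using that * \<omega> by (auto simp: D_def \<theta>_def big_def)
    qed
    have "pairwise disjnt D"
    proof (rule pairwiseI)
      fix I I' assume I: "I \<in> D" "I' \<in> D" "I \<noteq> I'"
      show "disjnt I I'"
      proof (rule ccontr)
        assume "\<not> disjnt I I'"
        then obtain i where i: "i \<in> I" "i \<in> I'" by (auto simp: disjnt_def)
        have "i \<in> {1..n}" using i I by (auto simp: D_def K_def interaction_sets_def)
        moreover have "I \<in> R i" "I' \<in> R i" using i I DP by (auto simp: R_def D_def)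
        ultimately have "\<omega> \<in> B\<^sub>3" using I DP unfolding B\<^sub>3_def by blast
        then show False using \<omega> by auto
      qed
    qed
    moreover have "D \<subseteq> interaction_sets n" by (auto simp: D_def K_def)
    ultimately have "ground_state_energy a n (\<lambda>I. X I \<omega>) / n \<le> max_coupling a n (\<lambda>I. X I \<omega>)
        + sqrt (exp 1 * (\<Sum>I\<in>K - D. (a (card I) * X I \<omega>)\<^sup>2))"
      unfolding K_def by (intro ground_state_energy_le n)
    \<comment> \<open>Outside \<open>D\<close> nothing is cut off, so truncated and true squares
      agree.\<close>
    also have "(\<Sum>I\<in>K - D. (a (card I) * X I \<omega>)\<^sup>2) = (\<Sum>I\<in>K - D. (a (card I))\<^sup>2 * sq_below (\<theta> I) (X I \<omega>))"
      by (intro sum.cong) (auto simp: D_def sq_below_def power_mult_distrib)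
    also have "\<dots> \<le> S \<omega>" unfolding S_def by (intro sum_mono2) (auto simp: fK)
    also have "\<dots> \<le> s" using \<omega> by (auto simp: B\<^sub>1_def)
    finally have "ground_state_energy a n (\<lambda>I. X I \<omega>) / n \<le> max_coupling a n (\<lambda>I. X I \<omega>) + sqrt (exp 1 * s)"
      by simp
    with max_coupling_le_ground_state_energy[OF n, of a "\<lambda>I. X I \<omega>"] \<omega> show "\<omega> \<in> ?G"
      by auto
  qed
  have "prob (B\<^sub>1 \<union> B\<^sub>2 \<union> B\<^sub>3) \<le> prob B\<^sub>1 + prob B\<^sub>2 + prob B\<^sub>3"
    using measure_Un_le[of "B\<^sub>1 \<union> B\<^sub>2" M "B\<^sub>3"] measure_Un_le[of B\<^sub>1 M B\<^sub>2] B1 B2 B3 by auto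
  moreover have "prob (space M - (B\<^sub>1 \<union> B\<^sub>2 \<union> B\<^sub>3)) = 1 - prob (B\<^sub>1 \<union> B\<^sub>2 \<union> B\<^sub>3)"
    using B1 B2 B3 by (intro prob_compl) auto
  moreover have "prob (space M - (B\<^sub>1 \<union> B\<^sub>2 \<union> B\<^sub>3)) \<le> prob ?G"
    using sub G by (rule finite_measure_mono)
  ultimately show ?thesis using P1 P2 P3 unfolding e_def by linarith
qed

section \<open>Choice of the thresholds and the resulting rates\<close>

text \<open>With \<open>T\<close> the weighted sum of the coefficients, one factor of
  \<open>(a p)\<^sup>2\<close> is bounded by \<open>T\<close> and the other is kept: summing it
  gives the first bound, its geometric decay the second, both with the constant
  \<open>T\<^sup>2\<close>.\<close>

lemma coefficient_bounds:
  fixes a :: "nat \<Rightarrow> real"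
  assumes "\<eta> > 0" and "(\<lambda>p. \<bar>a p\<bar> * (1 + \<eta>) ^ p) summable_on {2..}"
  obtains S where "S \<ge> 0" "\<And>n. (\<Sum>p=2..n. (a p)\<^sup>2) \<le> S"
    "\<And>p. p \<ge> 2 \<Longrightarrow> (a p)\<^sup>2 \<le> S * (1 + \<eta>) powr (- real p)"
proof -
  define T where "T = infsum (\<lambda>p. \<bar>a p\<bar> * (1 + \<eta>) ^ p) {2..}"
  have fin: "(\<Sum>p\<in>F. \<bar>a p\<bar> * (1 + \<eta>) ^ p) \<le> T" if "finite F" "F \<subseteq> {2..}" for F
    unfolding T_def using that assms by (intro finite_sum_le_infsum) auto
  have T0: "T \<ge> 0" using fin[of "{}"] by simp
  have pow: "1 \<le> (1 + \<eta>) ^ p" for p :: nat using assms by (intro one_le_power) simp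
  have weighted: "\<bar>a p\<bar> * (1 + \<eta>) ^ p \<le> T" if "p \<ge> 2" for p
    using fin[of "{p}"] that by simp
  have le: "\<bar>a p\<bar> \<le> \<bar>a p\<bar> * (1 + \<eta>) ^ p" for p
    using mult_left_mono[OF pow, of "\<bar>a p\<bar>" p] by simp
  have sq: "(a p)\<^sup>2 \<le> T * \<bar>a p\<bar>" if "p \<ge> 2" for p
    using mult_right_mono[OF order_trans[OF le weighted[OF that]], of "\<bar>a p\<bar>"]
    by (simp add: power2_eq_square abs_mult_self_eq)
  show ?thesis
  proof (rule that[of "T\<^sup>2"])
    fix n
    have "(\<Sum>p=2..n. (a p)\<^sup>2) \<le> (\<Sum>p=2..n. T * (\<bar>a p\<bar> * (1 + \<eta>) ^ p))"
    proof (rule sum_mono)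
      fix p assume "p \<in> {2..n}"
      then show "(a p)\<^sup>2 \<le> T * (\<bar>a p\<bar> * (1 + \<eta>) ^ p)"
        using sq[of p] mult_left_mono[OF le[of p] T0] by simp
    qed
    also have "\<dots> \<le> T * T"
      unfolding sum_distrib_left[symmetric] using T0 by (intro mult_left_mono fin) auto
    finally show "(\<Sum>p=2..n. (a p)\<^sup>2) \<le> T\<^sup>2" by (simp add: power2_eq_square)
  next
    fix p :: nat assume p: "p \<ge> 2"
    have "\<bar>a p\<bar> \<le> T * (1 + \<eta>) powr (- real p)"
      using weighted[OF p] assms by (simp add: powr_minus powr_realpow field_simps)
    then have "T * \<bar>a p\<bar> \<le> T * (T * (1 + \<eta>) powr (- real p))"
      using T0 by (intro mult_left_mono)
    then show "(a p)\<^sup>2 \<le> T\<^sup>2 * (1 + \<eta>) powr (- real p)"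
      using sq[OF p] by (simp add: power2_eq_square)
  qed simp
qed

text \<open>A zero scale makes the quotient 0 by convention, so such a coupling never exceeds a
  positive level and obeys every tail bound.\<close>

lemma normalized_tail:
  assumes N: "prob_space N" and H: "H \<in> borel_measurable N" and M: "prob_space M"
    and h: "h \<in> borel_measurable M" "distr M borel h = distr N borel H"
    and "p \<le> n" "u > 0"
  shows "measure M {\<omega> \<in> space M. \<bar>h \<omega> / scale N H n p\<bar> > u} =
    (if scale N H n p = 0 then 0 else abs_tail N H (u * scale N H n p))"
proof (cases "scale N H n p = 0")
  case True
  then show ?thesis using assms by simp
next
  case False
  then have b: "scale N H n p > 0" using scale_nonneg[OF N H \<open>p \<le> n\<close>] by simp
  let ?A = "{y :: real. \<bar>y\<bar> > u * scale N H n p}"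
  have A: "?A \<in> sets borel" by measurable
  have "{\<omega> \<in> space M. \<bar>h \<omega> / scale N H n p\<bar> > u} = h -` ?A \<inter> space M"
    using b by (auto simp: field_simps)
  then have "measure M {\<omega> \<in> space M. \<bar>h \<omega> / scale N H n p\<bar> > u} = measure (distr M borel h) ?A"
    using h(1) A by (simp add: measure_distr)
  also have "\<dots> = measure N (H -` ?A \<inter> space N)"
    unfolding h(2) using H A by (simp add: measure_distr)
  also have "H -` ?A \<inter> space N = {\<omega> \<in> space N. \<bar>H \<omega>\<bar> > u * scale N H n p}" by auto
  finally show ?thesis using False by (simp add: abs_tail_def)
qed

text \<open>Sizes up to \<open>P\<close> share the total \<open>S\<close>; each of the at most n
  larger sizes is charged the geometric decay at \<open>P\<close>.\<close>

lemma truncation_budget: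
  fixes a :: "nat \<Rightarrow> real"
  assumes a: "\<And>n. (\<Sum>p=2..n. (a p)\<^sup>2) \<le> S" "\<And>p. p \<ge> 2 \<Longrightarrow> (a p)\<^sup>2 \<le> S * (1 + \<eta>) powr (- real p)"
    and "\<eta> > 0" "S \<ge> 0" "A \<ge> 0" "B \<ge> 0"
  shows "(\<Sum>p=2..n. (a p)\<^sup>2 * (if real p \<le> P then A else B)) \<le> S * A + n * (S * (1 + \<eta>) powr (- P) * B)"
proof -
  have "(\<Sum>p=2..n. (a p)\<^sup>2 * (if real p \<le> P then A else B))
      \<le> (\<Sum>p=2..n. (a p)\<^sup>2 * A + S * (1 + \<eta>) powr (- P) * B)"
  proof (rule sum_mono)
    fix p assume p: "p \<in> {2..n}"
    show "(a p)\<^sup>2 * (if real p \<le> P then A else B) \<le> (a p)\<^sup>2 * A + S * (1 + \<eta>) powr (- P) * B"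
    proof (cases "real p \<le> P")
      case False
      have "(a p)\<^sup>2 \<le> S * (1 + \<eta>) powr (- real p)" using a(2) p by simp
      also have "\<dots> \<le> S * (1 + \<eta>) powr (- P)"
        using False assms by (intro mult_left_mono powr_mono) auto
      finally show ?thesis using False assms by (simp add: mult_right_mono add_increasing)
    qed (use assms in auto)
  qed
  also have "\<dots> = (\<Sum>p=2..n. (a p)\<^sup>2) * A + real (n - 1) * (S * (1 + \<eta>) powr (- P) * B)"
    by (simp add: sum.distrib sum_distrib_right)
  also have "\<dots> \<le> S * A + n * (S * (1 + \<eta>) powr (- P) * B)"
    using assms by (intro add_mono mult_right_mono a(1)) auto
  finally show ?thesis .
qed

text \<open>After taking logarithms this is the growth of n^(1/8) over ln n. Later \<open>b\<close>
  is \<open>6 / \<gamma> + 1 + e\<close>, which pays for n times \<open>U\<^sup>2\<close> and a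
  further factor n^e.\<close>

lemma stretched_exponential_decay:
  fixes b :: real
  assumes "\<eta> > 0"
  shows "eventually (\<lambda>n :: nat. real n powr b * (1 + \<eta>) powr (- (real n powr (1 / 8))) \<le> 1) at_top"
proof -
  have l: "ln (1 + \<eta>) > 0" using assms by simp
  have "((\<lambda>n :: nat. b * (ln (real n) / real n powr (1 / 8))) \<longlongrightarrow> b * 0) at_top"
    by (intro tendsto_mult tendsto_const lim_ln_over_power) simp
  then have "eventually (\<lambda>n :: nat. b * (ln (real n) / real n powr (1 / 8)) < ln (1 + \<eta>)) at_top"
    using l by (intro order_tendstoD(2)[of _ "b * 0"]) auto
  then show ?thesis using eventually_gt_at_top[of 0]
  proof eventually_elim
    case (elim n)
    then have "b * ln (real n) \<le> real n powr (1 / 8) * ln (1 + \<eta>)"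
      by (simp add: field_simps)
    then have "exp (b * ln (real n) - real n powr (1 / 8) * ln (1 + \<eta>)) \<le> 1" by simp
    then show ?case using elim assms by (simp add: powr_def exp_diff exp_minus field_simps)
  qed
qed

text \<open>The three failure probabilities of \<open>ground_state_energy_concentration\<close> at the thresholds
  \<open>n powr (- 1/16)\<close> and \<open>n powr (3 / \<gamma>)\<close>.\<close>
lemma failure_probability_budget:
  fixes a :: "nat \<Rightarrow> real" and n :: nat and C c e s S P U \<beta> \<gamma> \<eta> \<tau> :: real
  assumes n: "n \<ge> 1"
    and \<beta>: "1 < \<beta>" "\<beta> < 2" and \<gamma>: "0 < \<gamma>" and C: "C \<ge> 1" and c0: "0 \<le> c" and \<eta>: "\<eta> > 0"
    and S: "S \<ge> 0" "\<And>n. (\<Sum>p=2..n. (a p)\<^sup>2) \<le> S"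
      "\<And>p. p \<ge> 2 \<Longrightarrow> (a p)\<^sup>2 \<le> S * (1 + \<eta>) powr (- real p)"
    and e_def: "e = (2 - \<beta>) / 16"
    and dec: "real n powr (6 / \<gamma> + 1 + e) * (1 + \<eta>) powr (- (real n powr (1 / 8))) \<le> 1"
    and \<tau>_def: "\<tau> = real n powr (- 1 / 16)" and U_def: "U = real n powr (3 / \<gamma>)"
    and P_def: "P = real n powr (1 / 8)" and s_def: "s = real n powr (- (e / 2))"
  shows "(\<Sum>p=2..n. (a p)\<^sup>2 * (if real p \<le> P then c * C * \<tau> powr (2 - \<beta>) else (c + 1) * C * U\<^sup>2)) / s
      + n * C * U powr (- \<gamma>) + (C * \<tau> powr (- \<beta>) * P\<^sup>2)\<^sup>2 / n
    \<le> ((2 * c + 1) * C * S + C + C\<^sup>2) * real n powr (- (e / 2))"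
proof -
  have n1: "1 \<le> real n" "0 < real n" using n by auto
  have e: "0 < e" "e < 1 / 16" using \<beta> by (auto simp: e_def)
  have \<tau>_powr: "\<tau> powr (2 - \<beta>) = real n powr (- e)"
    by (simp add: \<tau>_def e_def powr_powr)
  have b1: "(\<Sum>p=2..n. (a p)\<^sup>2 * (if real p \<le> P then c * C * \<tau> powr (2 - \<beta>) else (c + 1) * C * U\<^sup>2)) / s
      \<le> (2 * c + 1) * C * S * real n powr (- (e / 2))"
  proof -
    have "(\<Sum>p=2..n. (a p)\<^sup>2 * (if real p \<le> P then c * C * \<tau> powr (2 - \<beta>) else (c + 1) * C * U\<^sup>2))
        \<le> S * (c * C * real n powr (- e)) + n * (S * (1 + \<eta>) powr (- P) * ((c + 1) * C * U\<^sup>2))"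
      unfolding \<tau>_powr[symmetric] using S c0 C \<eta> by (intro truncation_budget) auto
    \<comment> \<open>The surplus exponent \<open>e\<close> in \<open>dec\<close> makes the large
      sizes decay at the same rate n^(-e) as the small ones.\<close>
    also have "n * (S * (1 + \<eta>) powr (- P) * ((c + 1) * C * U\<^sup>2))
        = (c + 1) * C * S * ((real n powr (6 / \<gamma> + 1 + e) * (1 + \<eta>) powr (- (real n powr (1 / 8)))) * real n powr (- e))"
    proof -
      have "real n * U\<^sup>2 = real n powr (6 / \<gamma> + 1 + e) * real n powr (- e)"
        using n1 by (simp add: U_def powr_add[symmetric] powr_power powr_mult_base add.commute)
      then show ?thesis by (simp add: P_def mult_ac)
    qed
    also have "\<dots> \<le> (c + 1) * C * S * (1 * real n powr (- e))"
      using dec c0 C S by (intro mult_left_mono mult_right_mono) auto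
    finally have "(\<Sum>p=2..n. (a p)\<^sup>2 * (if real p \<le> P then c * C * \<tau> powr (2 - \<beta>) else (c + 1) * C * U\<^sup>2))
        \<le> (2 * c + 1) * C * S * real n powr (- e)" by (simp add: algebra_simps)
    then have "(\<Sum>p=2..n. (a p)\<^sup>2 * (if real p \<le> P then c * C * \<tau> powr (2 - \<beta>) else (c + 1) * C * U\<^sup>2)) / s
        \<le> (2 * c + 1) * C * S * real n powr (- e) / s"
      by (rule divide_right_mono) (simp add: s_def)
    also have "\<dots> = (2 * c + 1) * C * S * (real n powr (- e) / s)" by simp
    also have "real n powr (- e) / s = real n powr (- (e / 2))"
      using n1 by (simp add: s_def powr_diff[symmetric])
    finally show ?thesis .
  qed
  \<comment> \<open>The exponent 3 in \<open>U\<close> leaves n * n^(-3) after the union over all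
    sizes.\<close>
  have b2: "n * C * U powr (- \<gamma>) \<le> C * real n powr (- (e / 2))"
  proof -
    have "n * C * U powr (- \<gamma>) = C * real n powr (- 2)"
      using n1 \<beta> \<gamma> by (simp add: U_def powr_powr powr_mult_base mult.commute mult.left_commute)
    also have "\<dots> \<le> C * real n powr (- (e / 2))"
      using n1 C e by (intro mult_left_mono powr_mono) auto
    finally show ?thesis .
  qed
  have b3: "(C * \<tau> powr (- \<beta>) * P\<^sup>2)\<^sup>2 / n \<le> C\<^sup>2 * real n powr (- (e / 2))"
  proof -
    have "(\<tau> powr (- \<beta>) * P\<^sup>2)\<^sup>2 / n = real n powr (\<beta> / 8 + 1 / 2 - 1)"
    proof -
      have "\<tau> powr (- \<beta>) * P\<^sup>2 = real n powr (\<beta> / 16 + 1 / 4)"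
        using n1 by (simp add: \<tau>_def P_def powr_powr powr_power powr_add)
      then have "(\<tau> powr (- \<beta>) * P\<^sup>2)\<^sup>2 = real n powr (\<beta> / 8 + 1 / 2)"
        by (simp add: power2_eq_square powr_add[symmetric])
      moreover have "real n powr (\<beta> / 8 + 1 / 2 - 1) = real n powr (\<beta> / 8 + 1 / 2) / n"
        using n1 powr_diff[of "real n" "\<beta> / 8 + 1 / 2" 1] by simp
      ultimately show ?thesis by simp
    qed
    \<comment> \<open>As \<open>\<beta> < 2\<close>, the exponent on the left is below -1/4, while
      \<open>e / 2\<close> is below 1/32.\<close>
    also have "\<dots> \<le> real n powr (- (e / 2))"
      using n1 e \<beta> \<gamma> by (intro powr_mono) auto
    finally have "C\<^sup>2 * ((\<tau> powr (- \<beta>) * P\<^sup>2)\<^sup>2 / n) \<le> C\<^sup>2 * real n powr (- (e / 2))"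
      by (intro mult_left_mono) auto
    then show ?thesis by (simp add: power_mult_distrib mult_ac)
  qed
  show ?thesis using b1 b2 b3 by (simp add: distrib_right)
qed

lemma (in prob_space) prob_both_large:
  fixes X :: "'i \<Rightarrow> 'a \<Rightarrow> real"
  assumes X: "indep_vars (\<lambda>_. borel) X K" and I: "I \<in> K" "I' \<in> K" "I \<noteq> I'"
  shows "prob {\<omega> \<in> space M. \<bar>X I \<omega> / b I\<bar> > u \<and> \<bar>X I' \<omega> / b I'\<bar> > u}
    = prob {\<omega> \<in> space M. \<bar>X I \<omega> / b I\<bar> > u} * prob {\<omega> \<in> space M. \<bar>X I' \<omega> / b I'\<bar> > u}"
proof -
  define A where "A J = {\<omega> \<in> space M. \<bar>X J \<omega> / b J\<bar> > u}" for J
  have A: "A J = X J -` {y. \<bar>y / b J\<bar> > u} \<inter> space M" for J by (auto simp: A_def)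
  have "prob (\<Inter>J\<in>{I, I'}. A J) = (\<Prod>J\<in>{I, I'}. prob (A J))"
    unfolding A using I by (intro indep_varsD[OF X]) auto
  then have "prob (A I \<inter> A I') = prob (A I) * prob (A I')" using I(3) by simp
  moreover have "A I \<inter> A I' = {\<omega> \<in> space M. \<bar>X I \<omega> / b I\<bar> > u \<and> \<bar>X I' \<omega> / b I'\<bar> > u}"
    by (auto simp: A_def)
  ultimately show ?thesis by (simp only: A_def)
qed

theorem theorem1p8:
  fixes N :: "'b measure" and H :: "'b \<Rightarrow> real" and \<alpha> :: real
    and a :: "nat \<Rightarrow> real" and \<eta> :: real
    and M :: "nat \<Rightarrow> 'a measure" and H' :: "nat \<Rightarrow> nat set \<Rightarrow> 'a \<Rightarrow> real"
  assumes "prob_space N" and "H \<in> borel_measurable N" and "heavy_tailed N H \<alpha>"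
    and "\<eta> > 0" and "(\<lambda>p. \<bar>a p\<bar> * (1 + \<eta>) ^ p) summable_on {2..}"
    and "\<And>n. prob_space (M n)"
    and "\<And>n. prob_space.indep_vars (M n) (\<lambda>_. borel) (H' n) {I. I \<subseteq> {1..n} \<and> 2 \<le> card I}"
    and "\<And>n I. I \<subseteq> {1..n} \<Longrightarrow> 2 \<le> card I \<Longrightarrow> distr (M n) borel (H' n I) = distr N borel H"
  shows "\<exists>\<epsilon>'>0. \<exists>C::real. with_high_probability M (\<lambda>n. {\<omega> \<in> space (M n).
           let J = normalized N H n (\<lambda>I. H' n I \<omega>)
           in \<bar>ground_state_energy a n J / real n - max_coupling a n J\<bar> \<le> C * real n powr (- \<epsilon>')})"
proof -
  note N = assms(1) and H = assms(2) and ht = assms(3) and M = assms(6)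
  have \<alpha>: "0 < \<alpha>" "\<alpha> < 2" using ht by (auto simp: heavy_tailed_def)
  \<comment> \<open>Midpoints of \<alpha> and 2, and of 0 and \<alpha>: both tail exponents get
    room, and \<open>2 - \<beta>\<close> stays positive.\<close>
  define \<beta> \<gamma> where "\<beta> = (\<alpha> + 2) / 2" and "\<gamma> = \<alpha> / 2"
  have \<beta>\<gamma>: "0 < \<gamma>" "\<gamma> < \<alpha>" "\<alpha> < \<beta>" "1 < \<beta>" "\<beta> < 2" using \<alpha> by (auto simp: \<beta>_def \<gamma>_def)
  obtain C n\<^sub>0 where C: "C \<ge> 1"
    and T0: "\<And>n p u. n \<ge> n\<^sub>0 \<Longrightarrow> 2 \<le> p \<Longrightarrow> p \<le> n \<Longrightarrow> 0 < scale N H n p \<Longrightarrow> 0 < u \<Longrightarrow> u \<le> 1 \<Longrightarrow>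
        abs_tail N H (u * scale N H n p) \<le> C * u powr (- \<beta>) / real (n choose p)"
    and T1: "\<And>n p u. n \<ge> n\<^sub>0 \<Longrightarrow> 2 \<le> p \<Longrightarrow> p \<le> n \<Longrightarrow> 0 < scale N H n p \<Longrightarrow> 1 \<le> u \<Longrightarrow>
        abs_tail N H (u * scale N H n p) \<le> C * u powr (- \<gamma>) / real (n choose p)"
    using scaled_tail_bound[OF N H ht \<beta>\<gamma>(1-3)] by blast
  obtain S where S: "S \<ge> 0" "\<And>n. (\<Sum>p=2..n. (a p)\<^sup>2) \<le> S"
    "\<And>p. p \<ge> 2 \<Longrightarrow> (a p)\<^sup>2 \<le> S * (1 + \<eta>) powr (- real p)"
    using coefficient_bounds[OF assms(4,5)] by blast
  define c where "c = 2 powr \<beta> / (1 - 2 powr (\<beta> - 2))"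
  have c0: "0 \<le> c"
    using powr_less_mono[of "\<beta> - 2" 0 2] \<beta>\<gamma> by (simp add: c_def)
  define e where "e = (2 - \<beta>) / 16"
  have e: "0 < e" "e < 1 / 16" using \<beta>\<gamma> by (auto simp: e_def)
  define X where "X n I \<omega> = H' n I \<omega> / scale N H n (card I)" for n I \<omega>
  have normalized_eq: "normalized N H n (\<lambda>I. H' n I \<omega>) = (\<lambda>I. X n I \<omega>)" for n \<omega>
    by (rule ext) (simp add: normalized_def X_def)
  have H'_meas: "H' n I \<in> borel_measurable (M n)" if "I \<in> interaction_sets n" for n I
    using assms(7)[of n] that unfolding prob_space.indep_vars_def[OF M] interaction_sets_def by blast
  then have X_meas: "X n I \<in> borel_measurable (M n)" if "I \<in> interaction_sets n" for n I
    using that unfolding X_def by simp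
  \<comment> \<open>The exponent \<open>e\<close> is halved twice: Markov at level n^(-e/2) leaves
    that same rate as failure probability, and the square root from Cauchy-Schwarz turns the level
    into an error of order n^(-e/4).\<close>
  define E where "E n = {\<omega> \<in> space (M n). \<bar>ground_state_energy a n (\<lambda>I. X n I \<omega>) / n
      - max_coupling a n (\<lambda>I. X n I \<omega>)\<bar> \<le> sqrt (exp 1) * real n powr (- (e / 4))}" for n
  have E_sets: "E n \<in> sets (M n)" for n
    using measurable_ground_state_energy[of n "X n" "M n" a] measurable_max_coupling[of n "X n" "M n" a] X_meas
    unfolding E_def by measurable
  define Q where "Q = (2 * c + 1) * C * S + C + C\<^sup>2"
  have main: "measure (M n) (E n) \<ge> 1 - Q * real n powr (- (e / 2))"
    if n: "n \<ge> n\<^sub>0" "n \<ge> 2"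
      and dec: "real n powr (6 / \<gamma> + 1 + e) * (1 + \<eta>) powr (- (real n powr (1 / 8))) \<le> 1" for n
  proof -
    define \<tau> U P s where "\<tau> = real n powr (- 1 / 16)" and "U = real n powr (3 / \<gamma>)"
      and "P = real n powr (1 / 8)" and "s = real n powr (- (e / 2))"
    have n1: "1 \<le> real n" "0 < real n" using n by auto
    have tail: "measure (M n) {\<omega> \<in> space (M n). \<bar>X n I \<omega>\<bar> > u}
        = (if scale N H n (card I) = 0 then 0 else abs_tail N H (u * scale N H n (card I)))"
      if "I \<in> interaction_sets n" "u > 0" for I u
      unfolding X_def using that assms(8) card_interaction_le[of I n]
      by (intro normalized_tail N H M H'_meas) (auto simp: interaction_sets_def)
    have scale0: "0 \<le> scale N H n (card I)" if "I \<in> interaction_sets n" for I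
      using card_interaction_le[OF that] by (intro scale_nonneg N H)
    have conc: "measure (M n) {\<omega> \<in> space (M n). \<bar>ground_state_energy a n (\<lambda>I. X n I \<omega>) / n
          - max_coupling a n (\<lambda>I. X n I \<omega>)\<bar> \<le> sqrt (exp 1 * s)}
      \<ge> 1 - ((\<Sum>p=2..n. (a p)\<^sup>2 * (if real p \<le> P then c * C * \<tau> powr (2 - \<beta>) else (c + 1) * C * U\<^sup>2)) / s
        + n * C * U powr (- \<gamma>) + (C * \<tau> powr (- \<beta>) * P\<^sup>2)\<^sup>2 / n)"
      unfolding c_def
    proof (rule prob_space.ground_state_energy_concentration[OF M])
      show "X n I \<in> borel_measurable (M n)" if "I \<in> interaction_sets n" for I
        by (rule X_meas[OF that])
    next
      fix I I' u assume I: "I \<in> interaction_sets n" "I' \<in> interaction_sets n" "I \<noteq> I'"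
      then show "measure (M n) {\<omega> \<in> space (M n). \<bar>X n I \<omega>\<bar> > u \<and> \<bar>X n I' \<omega>\<bar> > u}
          = measure (M n) {\<omega> \<in> space (M n). \<bar>X n I \<omega>\<bar> > u} * measure (M n) {\<omega> \<in> space (M n). \<bar>X n I' \<omega>\<bar> > u}"
        unfolding X_def
        by (intro prob_space.prob_both_large[OF M assms(7)]) (simp_all add: interaction_sets_def)
    next
      fix I and u :: real assume I: "I \<in> interaction_sets n" and u: "0 < u" "u \<le> 1"
      show "measure (M n) {\<omega> \<in> space (M n). \<bar>X n I \<omega>\<bar> > u} \<le> C * u powr (- \<beta>) / real (n choose card I)"
        using tail[OF I u(1)] T0[of n "card I" u] n u C I scale0[OF I] card_interaction_le[OF I]
        by (auto simp: interaction_sets_def)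
    next
      fix I and u :: real assume I: "I \<in> interaction_sets n" and u: "1 \<le> u"
      show "measure (M n) {\<omega> \<in> space (M n). \<bar>X n I \<omega>\<bar> > u} \<le> C * u powr (- \<gamma>) / real (n choose card I)"
        using tail[OF I, of u] T1[of n "card I" u] n u C I scale0[OF I] card_interaction_le[OF I]
        by (auto simp: interaction_sets_def)
    next
      show "\<tau> \<le> 1" unfolding \<tau>_def using powr_mono[of "- 1 / 16" 0 "real n"] n1 by simp
      show "1 \<le> U" unfolding U_def using n1 \<beta>\<gamma> by (intro ge_one_powr_ge_zero) auto
    qed (use n1 n C \<beta>\<gamma> in \<open>auto simp: \<tau>_def P_def s_def\<close>)
    have s_eq: "sqrt (exp 1 * s) = sqrt (exp 1) * real n powr (- (e / 4))"
      using n1 by (simp add: s_def real_sqrt_mult powr_half_sqrt[symmetric] powr_powr)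
    have "(\<Sum>p=2..n. (a p)\<^sup>2 * (if real p \<le> P then c * C * \<tau> powr (2 - \<beta>) else (c + 1) * C * U\<^sup>2)) / s
        + n * C * U powr (- \<gamma>) + (C * \<tau> powr (- \<beta>) * P\<^sup>2)\<^sup>2 / n \<le> Q * real n powr (- (e / 2))"
      unfolding Q_def
      by (rule failure_probability_budget[OF _ \<beta>\<gamma>(4,5,1) C c0 assms(4) S e_def dec \<tau>_def U_def P_def s_def])
        (use n in auto)
    then show ?thesis using conc unfolding E_def s_eq by linarith
  qed
  \<comment> \<open>High probability allows no constant in front of the power, so half of the
    exponent \<open>e / 2\<close> is spent on absorbing \<open>Q\<close>.\<close>
  have "((\<lambda>n :: nat. Q * real n powr (- (e / 4))) \<longlongrightarrow> Q * 0) at_top"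
    using e by (intro tendsto_mult tendsto_const tendsto_neg_powr filterlim_real_sequentially) auto
  then have "eventually (\<lambda>n :: nat. Q * real n powr (- (e / 4)) < 1) at_top"
    by (intro order_tendstoD(2)[of _ "Q * 0"]) auto
  then have "eventually (\<lambda>n :: nat. E n \<in> sets (M n) \<and> measure (M n) (E n) \<ge> 1 - real n powr (- (e / 4))) at_top"
    using stretched_exponential_decay[OF assms(4), of "6 / \<gamma> + 1 + e"] eventually_ge_at_top[of "max n\<^sub>0 2"]
  proof eventually_elim
    case (elim n)
    have "Q * real n powr (- (e / 2)) = (Q * real n powr (- (e / 4))) * real n powr (- (e / 4))"
      by (simp add: powr_add[symmetric])
    also have "\<dots> \<le> 1 * real n powr (- (e / 4))"
      using elim by (intro mult_right_mono) auto
    finally show ?case using main[of n] elim E_sets[of n] by auto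
  qed
  then obtain n\<^sub>1 where "\<And>n. n \<ge> n\<^sub>1 \<Longrightarrow> E n \<in> sets (M n) \<and> measure (M n) (E n) \<ge> 1 - real n powr (- (e / 4))"
    by (auto simp: eventually_sequentially)
  then have "with_high_probability M E"
    unfolding with_high_probability_def using e
    by (intro exI[of _ "e / 4"] conjI exI[of _ n\<^sub>1]) auto
  then show ?thesis
    using e unfolding E_def
    by (intro exI[of _ "e / 4"] conjI exI[of _ "sqrt (exp 1)"]) (auto simp: normalized_eq Let_def)
qed

end
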